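(* Let $\hat\alpha\in\mathrm{SL}(n,\mathbb{Z})$ (i.e. $\det\hat\alpha=1$). Then for $r=0,1,\dots,n$, $\wedge^r\hat\alpha-\mathrm{id}$ and $\wedge^{n-r}\hat\alpha-\mathrm{id}$ are equivalent as endomorphisms of $\Lambda^r\mathbb{Z}^n=\Lambda^{n-r}\mathbb{Z}^n=\mathbb{Z}^{\binom{n}{r}}$. Equivalently, $\mathrm{coker}(\wedge^r\hat\alpha-\mathrm{id})$ is isomorphic to $\mathrm{coker}(\wedge^{n-r}\hat\alpha-\mathrm{id})$ for $r=0,1,\dots,n$.
   Context: $\wedge^r\hat\alpha$ is the $r$-th exterior power of $\hat\alpha$ acting on $\Lambda^r\mathbb{Z}^n$. Endomorphisms $\hat\alpha,\hat\beta\in\mathrm{End}(\mathbb{Z}^m)$ are called equivalent (over $\mathbb{Z}$) if there exist $\hat u,\hat v\in\mathrm{Aut}(\mathbb{Z}^m)$ with $\hat u\circ\hat\alpha\circ\hat v=\hat\beta$. The modules $\Lambda^r\mathbb{Z}^n$ and $\Lambda^{n-r}\mathbb{Z}^n$ are both identified with $\mathbb{Z}^{\binom{n}{r}}$ by choosing bases (equivalence does not depend on the choice). *)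

theory Defs
  imports "Jordan_Normal_Form.Determinant" "HOL-Algebra.Free_Abelian_Groups" "HOL-Algebra.Generated_Groups"
begin

text \<open>Abelian groups are HOL-Algebra groups in multiplicative notation. For an abelian group \<open>G\<close>
  (i.e. a module over the integers), the exterior power \<open>\<Lambda>\<^sup>r G\<close> is the free abelian group on
  \<open>r\<close>-tuples of elements of \<open>G\<close>, modulo the relations making the class of a tuple
  additive in each entry and zero on tuples with a repeated entry. Additivity
  already gives linearity over the integers.\<close>

definition tuples :: "('a, 'b) monoid_scheme \<Rightarrow> nat \<Rightarrow> 'a list set" where
  "tuples G r = {xs. length xs = r \<and> set xs \<subseteq> carrier G}"

definition ext_rels :: "('a, 'b) monoid_scheme \<Rightarrow> nat \<Rightarrow> ('a list \<Rightarrow>\<^sub>0 int) set" where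
  "ext_rels G r =
     {frag_of (xs[i := x \<otimes>\<^bsub>G\<^esub> y]) - frag_of (xs[i := x]) - frag_of (xs[i := y]) | xs i x y.
        xs \<in> tuples G r \<and> i < r \<and> x \<in> carrier G \<and> y \<in> carrier G} \<union>
     {frag_of xs | xs i j. xs \<in> tuples G r \<and> i < j \<and> j < r \<and> xs ! i = xs ! j}"

definition ext_rel_group :: "('a, 'b) monoid_scheme \<Rightarrow> nat \<Rightarrow> ('a list \<Rightarrow>\<^sub>0 int) set" where
  "ext_rel_group G r = generate (free_Abelian_group (tuples G r)) (ext_rels G r)"

definition ext_power :: "nat \<Rightarrow> ('a, 'b) monoid_scheme \<Rightarrow> ('a list \<Rightarrow>\<^sub>0 int) set monoid" where
  "ext_power r G = free_Abelian_group (tuples G r) Mod ext_rel_group G r"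

definition wedge :: "('a, 'b) monoid_scheme \<Rightarrow> 'a list \<Rightarrow> ('a list \<Rightarrow>\<^sub>0 int) set" where
  "wedge G xs = ext_rel_group G (length xs) #>\<^bsub>free_Abelian_group (tuples G (length xs))\<^esub> frag_of xs"

text \<open>The endomorphism of \<open>\<Lambda>\<^sup>r G\<close> induced by an endomorphism \<open>f\<close> of \<open>G\<close>: extend the entrywise action
  of \<open>f\<close> on tuples linearly, and pass to the quotient. The set below is a singleton when \<open>f\<close> is an
  endomorphism of \<open>G\<close>; see \<open>ext_map_wedge\<close> and \<open>ext_map_hom\<close>.\<close>

definition ext_map ::
  "nat \<Rightarrow> ('a, 'b) monoid_scheme \<Rightarrow> ('a \<Rightarrow> 'a) \<Rightarrow> ('a list \<Rightarrow>\<^sub>0 int) set \<Rightarrow> ('a list \<Rightarrow>\<^sub>0 int) set" where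
  "ext_map r G f X =
     the_elem ((\<lambda>c. ext_rel_group G r #>\<^bsub>free_Abelian_group (tuples G r)\<^esub>
                      frag_extend (frag_of \<circ> map f) c) ` X)"

definition minus_id :: "('a, 'b) monoid_scheme \<Rightarrow> ('a \<Rightarrow> 'a) \<Rightarrow> 'a \<Rightarrow> 'a" where
  "minus_id G f x = f x \<otimes>\<^bsub>G\<^esub> inv\<^bsub>G\<^esub> x"

definition coker :: "('a, 'b) monoid_scheme \<Rightarrow> ('a \<Rightarrow> 'a) \<Rightarrow> 'a set monoid" where
  "coker G f = G Mod (f ` carrier G)"

definition equivalent_endos :: "('a, 'b) monoid_scheme \<Rightarrow> ('a \<Rightarrow> 'a) \<Rightarrow> ('a \<Rightarrow> 'a) \<Rightarrow> bool" where
  "equivalent_endos G f g \<longleftrightarrow>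
     (\<exists>u \<in> iso G G. \<exists>v \<in> iso G G. \<forall>x \<in> carrier G. u (f (v x)) = g x)"

text \<open>An isomorphism \<open>\<phi>\<close> from \<open>G\<close> to \<open>\<int>\<^sup>m\<close> is the same thing as a basis of \<open>G\<close>; \<open>transport\<close> reads an
  endomorphism of \<open>G\<close> in that basis.\<close>

definition transport :: "('a, 'b) monoid_scheme \<Rightarrow> ('a \<Rightarrow> 'c) \<Rightarrow> ('a \<Rightarrow> 'a) \<Rightarrow> 'c \<Rightarrow> 'c" where
  "transport G \<phi> f = \<phi> \<circ> f \<circ> inv_into (carrier G) \<phi>"

abbreviation Zpow :: "nat \<Rightarrow> int vec monoid" where
  "Zpow m \<equiv> monoid_vec TYPE(int) m"

abbreviation ext_power_Z :: "nat \<Rightarrow> nat \<Rightarrow> (int vec list \<Rightarrow>\<^sub>0 int) set monoid" where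
  "ext_power_Z r n \<equiv> ext_power r (Zpow n)"

text \<open>\<open>\<Lambda>\<^sup>r A - id\<close> for an integer \<open>n \<times> n\<close> matrix \<open>A\<close> acting on column vectors.\<close>

definition ext_minus_id ::
  "nat \<Rightarrow> nat \<Rightarrow> int mat \<Rightarrow> (int vec list \<Rightarrow>\<^sub>0 int) set \<Rightarrow> (int vec list \<Rightarrow>\<^sub>0 int) set" where
  "ext_minus_id r n A = minus_id (ext_power_Z r n) (ext_map r (Zpow n) ((*\<^sub>v) A))"


lemma ext_rels_subset:
  assumes "group G"
  shows "ext_rels G r \<subseteq> carrier (free_Abelian_group (tuples G r))"
proof -
  interpret group G by fact
  interpret F: group "free_Abelian_group (tuples G r)" by simp
  have up: "xs[i := x] \<in> tuples G r" if "xs \<in> tuples G r" "x \<in> carrier G" for xs i x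
    using that set_update_subset_insert[of xs i x] by (auto simp: tuples_def)
  have "frag_of (xs[i := x \<otimes>\<^bsub>G\<^esub> y]) - frag_of (xs[i := x]) - frag_of (xs[i := y])
      \<in> carrier (free_Abelian_group (tuples G r))"
    if "xs \<in> tuples G r" "x \<in> carrier G" "y \<in> carrier G" for xs i x y
  proof -
    have "Poly_Mapping.keys (frag_of (xs[i := x \<otimes>\<^bsub>G\<^esub> y]) - frag_of (xs[i := x]) - frag_of (xs[i := y]))
      \<subseteq> {xs[i := x \<otimes>\<^bsub>G\<^esub> y], xs[i := x], xs[i := y]}"
      using keys_diff[of "frag_of (xs[i := x \<otimes>\<^bsub>G\<^esub> y]) - frag_of (xs[i := x])" "frag_of (xs[i := y])"]
        keys_diff[of "frag_of (xs[i := x \<otimes>\<^bsub>G\<^esub> y])" "frag_of (xs[i := x])"] by auto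
    then show ?thesis using up[OF that(1)] that by fastforce
  qed
  then show ?thesis unfolding ext_rels_def by (auto simp: tuples_def)
qed

lemma ext_rel_group_normal:
  assumes "group G"
  shows "ext_rel_group G r \<lhd> free_Abelian_group (tuples G r)"
proof -
  interpret F: comm_group "free_Abelian_group (tuples G r)" by (rule abelian_free_Abelian_group)
  show ?thesis unfolding ext_rel_group_def
    by (intro F.subgroup_imp_normal F.generate_is_subgroup ext_rels_subset assms)
qed

lemma comm_group_ext_power:
  assumes "group G"
  shows "comm_group (ext_power r G)"
  unfolding ext_power_def
  by (intro comm_group.abelian_FactGroup abelian_free_Abelian_group normal_imp_subgroup
      ext_rel_group_normal assms)

lemma ext_map_coset:
  assumes "group G" "f \<in> hom G G" "c \<in> carrier (free_Abelian_group (tuples G r))"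
  shows "ext_map r G f (ext_rel_group G r #>\<^bsub>free_Abelian_group (tuples G r)\<^esub> c) =
    ext_rel_group G r #>\<^bsub>free_Abelian_group (tuples G r)\<^esub> frag_extend (frag_of \<circ> map f) c"
proof -
  let ?F = "free_Abelian_group (tuples G r)" and ?H = "ext_rel_group G r"
  let ?h = "frag_extend (frag_of \<circ> map f) :: _ \<Rightarrow> _"
  interpret G: group G by fact
  interpret F: comm_group ?F by (rule abelian_free_Abelian_group)
  interpret N: normal ?H ?F by (rule ext_rel_group_normal[OF assms(1)])
  have tup: "map f xs \<in> tuples G r" if "xs \<in> tuples G r" for xs
    using that assms(2) by (auto simp: tuples_def hom_def)
  have hcl: "?h c \<in> carrier ?F" if "c \<in> carrier ?F" for c
    using that tup keys_frag_extend[of "frag_of \<circ> map f" c] by fastforce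
  have rel: "?h c \<in> ext_rels G r" if "c \<in> ext_rels G r" for c
  proof -
    from that consider
      (add) xs i x y where "c = frag_of (xs[i := x \<otimes>\<^bsub>G\<^esub> y]) - frag_of (xs[i := x]) - frag_of (xs[i := y])"
        "xs \<in> tuples G r" "i < r" "x \<in> carrier G" "y \<in> carrier G"
      | (alt) xs i j where "c = frag_of xs" "xs \<in> tuples G r" "i < j" "j < r" "xs ! i = xs ! j"
      unfolding ext_rels_def by blast
    then show ?thesis
    proof cases
      case add
      have "?h c = frag_of ((map f xs)[i := f x \<otimes>\<^bsub>G\<^esub> f y]) - frag_of ((map f xs)[i := f x])
          - frag_of ((map f xs)[i := f y])"
        using add assms(2) by (simp add: frag_extend_diff map_update hom_def)
      moreover have "f x \<in> carrier G" "f y \<in> carrier G" using add assms(2) by (auto simp: hom_def)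
      ultimately show ?thesis using tup[OF add(2)] add(3) unfolding ext_rels_def by blast
    next
      case alt
      have "?h c = frag_of (map f xs)" "map f xs ! i = map f xs ! j"
        using alt by (auto simp: tuples_def)
      then show ?thesis using tup[OF alt(2)] alt(3,4) unfolding ext_rels_def by blast
    qed
  qed
  have hH: "?h c \<in> ?H" if "c \<in> ?H" for c
    using that unfolding ext_rel_group_def
  proof (induction rule: generate.induct)
    case one then show ?case using generate.one[of ?F] by simp
  next
    case (incl h) then show ?case by (intro generate.incl rel)
  next
    case (inv h)
    then have "h \<in> carrier ?F" "?h h \<in> carrier ?F" using ext_rels_subset[OF assms(1)] hcl by blast+
    then show ?case using generate.inv[OF rel[OF inv], of ?F] by (simp add: frag_extend_minus o_def)
  next
    case (eng h1 h2)
    then show ?case using generate.eng[of "?h h1" ?F] by (simp add: frag_extend_add o_def)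
  qed
  have "?H #>\<^bsub>?F\<^esub> ?h d = ?H #>\<^bsub>?F\<^esub> ?h c" if "d \<in> ?H #>\<^bsub>?F\<^esub> c" for d
  proof -
    from that obtain k where k: "k \<in> ?H" "d = k + c" by (auto simp: r_coset_def)
    then have "?h d \<in> ?H #>\<^bsub>?F\<^esub> ?h c" using hH by (auto simp: r_coset_def frag_extend_add)
    then show ?thesis
      using F.repr_independence[OF _ hcl[OF assms(3)] N.subgroup_axioms] by blast
  qed
  moreover have "c \<in> ?H #>\<^bsub>?F\<^esub> c"
    using F.rcos_self[OF assms(3) N.subgroup_axioms] .
  ultimately have "(\<lambda>c. ?H #>\<^bsub>?F\<^esub> ?h c) ` (?H #>\<^bsub>?F\<^esub> c) = {?H #>\<^bsub>?F\<^esub> ?h c}" by blast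
  then show ?thesis unfolding ext_map_def by simp
qed

lemma ext_map_wedge:
  assumes "group G" "f \<in> hom G G" "xs \<in> tuples G r"
  shows "ext_map r G f (wedge G xs) = wedge G (map f xs)"
  using ext_map_coset[OF assms(1,2), of "frag_of xs" r] assms(3)
  by (simp add: wedge_def tuples_def)

lemma ext_map_hom:
  assumes "group G" "f \<in> hom G G"
  shows "ext_map r G f \<in> hom (ext_power r G) (ext_power r G)"
proof -
  let ?F = "free_Abelian_group (tuples G r)" and ?H = "ext_rel_group G r"
  let ?h = "frag_extend (frag_of \<circ> map f) :: _ \<Rightarrow> _"
  interpret F: comm_group ?F by (rule abelian_free_Abelian_group)
  interpret N: normal ?H ?F by (rule ext_rel_group_normal[OF assms(1)])
  have tup: "map f xs \<in> tuples G r" if "xs \<in> tuples G r" for xs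
    using that assms(2) by (auto simp: tuples_def hom_def)
  have hcl: "?h c \<in> carrier ?F" if "c \<in> carrier ?F" for c
    using that tup keys_frag_extend[of "frag_of \<circ> map f" c] by fastforce
  show ?thesis
  proof (rule homI)
    fix X assume "X \<in> carrier (ext_power r G)"
    then obtain c where c: "c \<in> carrier ?F" "X = ?H #>\<^bsub>?F\<^esub> c"
      by (auto simp: ext_power_def FactGroup_def RCOSETS_def)
    then show "ext_map r G f X \<in> carrier (ext_power r G)"
      using ext_map_coset[OF assms c(1)] hcl[OF c(1)]
      by (auto simp: ext_power_def FactGroup_def RCOSETS_def)
  next
    fix X Y assume "X \<in> carrier (ext_power r G)" "Y \<in> carrier (ext_power r G)"
    then obtain c d where c: "c \<in> carrier ?F" "X = ?H #>\<^bsub>?F\<^esub> c"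
      and d: "d \<in> carrier ?F" "Y = ?H #>\<^bsub>?F\<^esub> d"
      by (auto simp: ext_power_def FactGroup_def RCOSETS_def)
    have cd: "c + d \<in> carrier ?F" using F.m_closed[OF c(1) d(1)] by simp
    have "X \<otimes>\<^bsub>ext_power r G\<^esub> Y = ?H #>\<^bsub>?F\<^esub> (c + d)"
      using N.rcos_sum[OF c(1) d(1)] c d by (simp add: ext_power_def FactGroup_def)
    moreover have "ext_map r G f X \<otimes>\<^bsub>ext_power r G\<^esub> ext_map r G f Y = ?H #>\<^bsub>?F\<^esub> (?h c + ?h d)"
      using N.rcos_sum[OF hcl[OF c(1)] hcl[OF d(1)]] ext_map_coset[OF assms c(1)]
        ext_map_coset[OF assms d(1)] c d by (simp add: ext_power_def FactGroup_def)
    ultimately show "ext_map r G f (X \<otimes>\<^bsub>ext_power r G\<^esub> Y) =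
        ext_map r G f X \<otimes>\<^bsub>ext_power r G\<^esub> ext_map r G f Y"
      using ext_map_coset[OF assms cd] by (simp add: frag_extend_add)
  qed
qed

end

theory Submission
  imports Defs "HOL-Combinatorics.Permutations"
begin

text \<open>The wedge product \<open>\<Lambda>\<^sup>r \<times> \<Lambda>\<^sup>n\<^sup>-\<^sup>r \<rightarrow> \<Lambda>\<^sup>n = \<int>\<close>, which on decomposable elements is an \<open>n \<times> n\<close> determinant,
  is a perfect pairing: complementary basis tuples pair to \<open>\<plusminus>1\<close>, all others to \<open>0\<close>. Since \<open>det A = 1\<close>,
  the pairing is invariant under \<open>A\<close>, so in these bases the matrices \<open>B\<close>, \<open>C\<close> of \<open>\<Lambda>\<^sup>r A\<close>, \<open>\<Lambda>\<^sup>n\<^sup>-\<^sup>r A\<close> satisfy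
  \<open>B\<^sup>T S C = S\<close> with \<open>S\<close> a diagonal matrix of signs. Hence \<open>C - 1 = C S (1 - B\<^sup>T) S\<close> is equivalent to
  \<open>(B - 1)\<^sup>T\<close>, and every square integer matrix is equivalent to its transpose because it is equivalent
  to a diagonal one.\<close>

section \<open>Equivalence of integer matrices\<close>


text \<open>The exterior powers are given only as quotients by relations, so neither their freeness
  nor their rank is known beforehand. Spanning by the wedges of increasing tuples of unit vectors
  comes from the relations; independence comes from the determinant, since freezing one argument of
  the pairing yields a homomorphism to the integers. The pairing therefore supplies the coordinates
  as well as the relation between \<open>B\<close> and \<open>C\<close>. In the formula for
  \<open>C - 1\<close> the factor \<open>C\<close> occurs on one side only, so already this step
  gives equivalence rather than conjugacy. The passage to the transpose is where division with
  remainder in the integers is used. The resulting equivalence is kept as a pair of isomorphisms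
  between two different groups, from which the statements about arbitrary bases and about cokernels
  both follow.\<close>

definition mat_equiv :: "nat \<Rightarrow> 'a::comm_ring_1 mat \<Rightarrow> 'a mat \<Rightarrow> bool" where
  "mat_equiv n M N \<longleftrightarrow> M \<in> carrier_mat n n \<and>
     (\<exists>P\<in>carrier_mat n n. \<exists>Q\<in>carrier_mat n n. det P dvd 1 \<and> det Q dvd 1 \<and> N = P * M * Q)"

lemma mat_equiv_carrier:
  assumes "mat_equiv n M N"
  shows "M \<in> carrier_mat n n" "N \<in> carrier_mat n n"
  using assms unfolding mat_equiv_def by auto

lemma mat_equivI:
  assumes "M \<in> carrier_mat n n" "P \<in> carrier_mat n n" "Q \<in> carrier_mat n n"
    and "det P dvd 1" "det Q dvd 1"
  shows "mat_equiv n M (P * M * Q)"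
  using assms unfolding mat_equiv_def by blast

lemma mat_equiv_left:
  assumes "M \<in> carrier_mat n n" "P \<in> carrier_mat n n" "det P dvd 1"
  shows "mat_equiv n M (P * M)"
  using mat_equivI[of M n P "1\<^sub>m n"] assms by simp

lemma mat_equiv_refl: "M \<in> carrier_mat n n \<Longrightarrow> mat_equiv n M M"
  using mat_equiv_left[of M n "1\<^sub>m n"] by simp

lemma mat_equiv_trans:
  assumes "mat_equiv n L M" "mat_equiv n M N"
  shows "mat_equiv n L N"
proof -
  from assms(1) obtain P Q where 1: "L \<in> carrier_mat n n" "P \<in> carrier_mat n n" "Q \<in> carrier_mat n n"
    "det P dvd 1" "det Q dvd 1" "M = P * L * Q" unfolding mat_equiv_def by blast
  from assms(2) obtain P' Q' where 2: "P' \<in> carrier_mat n n" "Q' \<in> carrier_mat n n"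
    "det P' dvd 1" "det Q' dvd 1" "N = P' * M * Q'" unfolding mat_equiv_def by blast
  have "N = (P' * P) * L * (Q * Q')" using 1 2
    by (simp add: assoc_mult_mat[of _ n n _ n _ n])
  moreover have "det (P' * P) dvd 1" "det (Q * Q') dvd 1"
    using 1 2 by (simp_all add: det_mult is_unit_mult_iff)
  ultimately show ?thesis using mat_equivI[of L n "P' * P" "Q * Q'"] 1 2 by simp
qed

lemma mat_equiv_transpose:
  assumes "mat_equiv n M N"
  shows "mat_equiv n (transpose_mat M) (transpose_mat N)"
proof -
  from assms obtain P Q where 1: "M \<in> carrier_mat n n" "P \<in> carrier_mat n n" "Q \<in> carrier_mat n n"
    "det P dvd 1" "det Q dvd 1" "N = P * M * Q" unfolding mat_equiv_def by blast
  have "transpose_mat N = transpose_mat Q * transpose_mat M * transpose_mat P" using 1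
    by (simp add: transpose_mult[of _ n n _ n] assoc_mult_mat[of _ n n _ n _ n])
  then show ?thesis using mat_equivI[of "transpose_mat M" n "transpose_mat Q" "transpose_mat P"] 1
    by (simp add: det_transpose)
qed

text \<open>Turns unit determinants, the form in which \<open>mat_equiv\<close> is easily checked,
  into inverses by Cramer's rule: the adjugate divided by the determinant.\<close>

lemma is_unit_detE:
  assumes "P \<in> carrier_mat n n" "det P dvd (1::'a::comm_ring_1)"
  obtains P' where "P' \<in> carrier_mat n n" "P * P' = 1\<^sub>m n" "P' * P = 1\<^sub>m n" "det P' dvd 1"
proof -
  from assms(2) obtain c where c: "1 = det P * c" by (auto elim: dvdE)
  define P' where "P' = c \<cdot>\<^sub>m adj_mat P"
  note adj = adj_mat[OF assms(1)]
  have P': "P' \<in> carrier_mat n n" using adj by (simp add: P'_def)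
  have one: "c \<cdot>\<^sub>m (det P \<cdot>\<^sub>m 1\<^sub>m n) = 1\<^sub>m n" using c by (intro eq_matI) (auto simp: mult.commute)
  have inv: "P * P' = 1\<^sub>m n" "P' * P = 1\<^sub>m n"
    using adj assms(1) one
    by (simp_all add: P'_def mult_smult_distrib[of _ n n _ n] mult_smult_assoc_mat[of _ n n _ n])
  have "det P * det P' = 1" using det_mult[OF assms(1) P'] inv by simp
  then have "det P' dvd 1" by (metis dvd_triv_right)
  then show thesis using that P' inv by blast
qed

lemma mat_equiv_sym:
  assumes "mat_equiv n M N"
  shows "mat_equiv n N M"
proof -
  from assms obtain P Q where 1: "M \<in> carrier_mat n n" "P \<in> carrier_mat n n" "Q \<in> carrier_mat n n"
    "det P dvd 1" "det Q dvd 1" "N = P * M * Q" unfolding mat_equiv_def by blast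
  obtain P' where P': "P' \<in> carrier_mat n n" "P' * P = 1\<^sub>m n" "det P' dvd 1"
    using is_unit_detE[OF 1(2,4)] by blast
  obtain Q' where Q': "Q' \<in> carrier_mat n n" "Q * Q' = 1\<^sub>m n" "det Q' dvd 1"
    using is_unit_detE[OF 1(3,5)] by blast
  have "P' * N * Q' = (P' * P) * M * (Q * Q')" using 1 P'(1) Q'(1)
    by (simp add: assoc_mult_mat[of _ n n _ n _ n])
  also have "\<dots> = M" using 1 P' Q' by simp
  finally show ?thesis using mat_equivI[of N n P' Q'] P' Q' mat_equiv_carrier[OF assms] by simp
qed

section \<open>Elimination over the integers\<close>

lemma det_swaprows_mat_unit:
  assumes "k < n" "l < n"
  shows "det (swaprows_mat n k l :: 'a::comm_ring_1 mat) dvd 1"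
proof -
  \<comment> \<open>A swap is its own inverse, an argument that also covers
    \<open>k = l\<close>.\<close>
  have "det (swaprows_mat n k l * swaprows_mat n k l :: 'a mat) = 1"
    using swaprows_mat_inv[OF assms, where 'a='a] by simp
  then have "det (swaprows_mat n k l :: 'a mat) * det (swaprows_mat n k l) = 1"
    by (simp add: det_mult[of _ n])
  then show ?thesis by (metis dvd_triv_right)
qed

lemma mat_equiv_swaprows:
  assumes "N \<in> carrier_mat n n" "k < n" "l < n"
  shows "mat_equiv n N (swaprows k l N)"
  unfolding swaprows_mat[OF assms]
  using mat_equiv_left[OF assms(1) swaprows_mat_carrier det_swaprows_mat_unit[OF assms(2,3)]] .

text \<open>One step of the Euclidean algorithm: subtracting a multiple of the top row leaves the
  remainder in row \<open>i\<close>, and a swap moves it to the corner. Non-divisibility makes it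
  nonzero, division makes it smaller in absolute value.\<close>

lemma reduce_corner:
  fixes N :: "int mat"
  assumes N: "N \<in> carrier_mat n n" and i: "i < n" and nz: "N $$ (0,0) \<noteq> 0"
    and nd: "\<not> N $$ (0,0) dvd N $$ (i,0)"
  obtains N' where "mat_equiv n N N'" "N' $$ (0,0) \<noteq> 0" "\<bar>N' $$ (0,0)\<bar> < \<bar>N $$ (0,0)\<bar>"
proof -
  define q where "q = N $$ (i,0) div N $$ (0,0)"
  have i0: "i \<noteq> 0" using nd by (metis dvd_refl)
  define N1 where "N1 = addrow (-q) i 0 N"
  have N1: "N1 \<in> carrier_mat n n" using N by (simp add: N1_def)
  have e1: "mat_equiv n N N1" unfolding N1_def
    using addrow_mat[OF N, of 0 "-q" i] mat_equiv_left[OF N, of "addrow_mat n (-q) i 0"] i i0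
    by (simp add: det_addrow_mat)
  have e2: "mat_equiv n N1 (swaprows 0 i N1)"
    using mat_equiv_swaprows[OF N1] i by simp
  have v: "swaprows 0 i N1 $$ (0,0) = N $$ (i,0) mod N $$ (0,0)"
    using i i0 N N1 unfolding N1_def q_def by (simp add: minus_div_mult_eq_mod[symmetric])
  show thesis
    using that[OF mat_equiv_trans[OF e1 e2]] nz nd unfolding v
    by (simp add: abs_mod_less dvd_eq_mod_eq_0)
qed

text \<open>A lower triangular \<open>L\<close> with unit diagonal performs all row operations at
  once. The top row survives, which later permits a second clearing along the row. A zero corner
  does no harm: divisibility makes the column zero, and division by \<open>0\<close> gives
  \<open>0\<close>, so \<open>L\<close> is the identity.\<close>

lemma clear_column:
  fixes N :: "int mat"
  assumes N: "N \<in> carrier_mat n n"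
    and dv: "\<And>i. i < n \<Longrightarrow> N $$ (0,0) dvd N $$ (i,0)"
  obtains N' where "mat_equiv n N N'" "\<And>j. j < n \<Longrightarrow> N' $$ (0,j) = N $$ (0,j)"
    "\<And>i. 0 < i \<Longrightarrow> i < n \<Longrightarrow> N' $$ (i,0) = 0"
proof -
  define L where "L = mat n n (\<lambda>(i,j). if i = j then 1 else if j = 0 then - (N $$ (i,0) div N $$ (0,0)) else 0)"
  have L: "L \<in> carrier_mat n n" by (simp add: L_def)
  have "det L = prod_list (diag_mat L)"
    by (rule det_lower_triangular[OF _ L]) (auto simp: L_def)
  also have "\<dots> = 1" unfolding prod_list_diag_prod by (rule prod.neutral) (auto simp: L_def)
  finally have dL: "det L = 1" .
  have entry: "(L * N) $$ (i,j) = (if i = 0 then N $$ (0,j)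
      else N $$ (i,j) - (N $$ (i,0) div N $$ (0,0)) * N $$ (0,j))" if "i < n" "j < n" for i j
  proof -
    have "(L * N) $$ (i,j) = (\<Sum>k=0..<n. L $$ (i,k) * N $$ (k,j))"
      using that N L by (simp add: scalar_prod_def)
    also have "\<dots> = (\<Sum>k\<in>{0,i}. L $$ (i,k) * N $$ (k,j))"
      using that by (intro sum.mono_neutral_right) (auto simp: L_def)
    also have "\<dots> = (if i = 0 then N $$ (0,j)
        else N $$ (i,j) - (N $$ (i,0) div N $$ (0,0)) * N $$ (0,j))"
      using that by (cases "i = 0") (auto simp: L_def)
    finally show ?thesis .
  qed
  show thesis
  proof (rule that)
    show "mat_equiv n N (L * N)" using mat_equiv_left[OF N L] dL by simp
  qed (use entry dv in auto)
qed

text \<open>Among the equivalent matrices with nonzero corner, take one whose corner is least in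
  absolute value. That corner divides its whole row and column, since a remainder would give a
  smaller one; both can then be cleared.\<close>

lemma mat_equiv_split_corner:
  fixes M :: "int mat"
  assumes M: "M \<in> carrier_mat (Suc n) (Suc n)"
  obtains d M' where "d \<in> carrier_mat 1 1" "M' \<in> carrier_mat n n"
    "mat_equiv (Suc n) M (four_block_mat d (0\<^sub>m 1 n) (0\<^sub>m n 1) M')"
proof -
  let ?n = "Suc n"
  have "\<exists>N. mat_equiv ?n M N \<and> (\<forall>i<?n. 0 < i \<longrightarrow> N $$ (i,0) = 0 \<and> N $$ (0,i) = 0)"
  proof (cases "\<exists>N. mat_equiv ?n M N \<and> N $$ (0,0) \<noteq> 0")
    case False
    have "M $$ (i,j) = 0" if "i < ?n" "j < ?n" for i j
    proof -
      \<comment> \<open>A column swap is a row swap of the transpose. Together with a row swap it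
        brings entry \<open>(i, j)\<close> to the corner, which is zero throughout the
        class.\<close>
      let ?N = "transpose_mat (swaprows 0 j (transpose_mat (swaprows 0 i M)))"
      have "mat_equiv ?n (transpose_mat (swaprows 0 i M)) (swaprows 0 j (transpose_mat (swaprows 0 i M)))"
        using that M by (intro mat_equiv_swaprows) auto
      from mat_equiv_transpose[OF this] have "mat_equiv ?n (swaprows 0 i M) ?N" by simp
      then have "mat_equiv ?n M ?N" 
        using mat_equiv_trans[OF mat_equiv_swaprows[OF M zero_less_Suc that(1)]] by blast
      moreover have "?N $$ (0,0) = M $$ (i,j)" using that M by simp
      ultimately show ?thesis using False by metis
    qed
    then show ?thesis using mat_equiv_refl[OF M] by auto
  next
    case True
    then obtain N where N: "mat_equiv ?n M N" "N $$ (0,0) \<noteq> 0"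
      and min: "\<And>N'. mat_equiv ?n M N' \<Longrightarrow> N' $$ (0,0) \<noteq> 0 \<Longrightarrow> nat \<bar>N $$ (0,0)\<bar> \<le> nat \<bar>N' $$ (0,0)\<bar>"
      using ex_has_least_nat[of "\<lambda>N. mat_equiv ?n M N \<and> N $$ (0,0) \<noteq> 0" _ "\<lambda>N. nat \<bar>N $$ (0,0)\<bar>"]
      by metis
    note Nc = mat_equiv_carrier(2)[OF N(1)]
    have col: "N $$ (0,0) dvd N $$ (i,0)" if i: "i < ?n" for i
    proof (rule ccontr)
      assume "\<not> ?thesis"
      then obtain N' where "mat_equiv ?n N N'" "N' $$ (0,0) \<noteq> 0" "\<bar>N' $$ (0,0)\<bar> < \<bar>N $$ (0,0)\<bar>"
        using reduce_corner[OF Nc i N(2)] by blast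
      then show False using min[of N'] mat_equiv_trans[OF N(1)] by auto
    qed
    have row: "N $$ (0,0) dvd N $$ (0,i)" if i: "i < ?n" for i
    proof (rule ccontr)
      assume "\<not> ?thesis"
      then obtain N' where N': "mat_equiv ?n (transpose_mat N) N'" "N' $$ (0,0) \<noteq> 0"
          "\<bar>N' $$ (0,0)\<bar> < \<bar>N $$ (0,0)\<bar>"
        using reduce_corner[of "transpose_mat N" ?n i] Nc i N(2) by auto
      have "mat_equiv ?n M (transpose_mat N')"
        using mat_equiv_trans[OF N(1)] mat_equiv_transpose[OF N'(1)] by simp
      moreover have "transpose_mat N' $$ (0,0) = N' $$ (0,0)" using mat_equiv_carrier(2)[OF N'(1)] by simp
      ultimately show False using min[of "transpose_mat N'"] N' by auto
    qed
    obtain N1 where N1: "mat_equiv ?n N N1" "\<And>j. j < ?n \<Longrightarrow> N1 $$ (0,j) = N $$ (0,j)"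
        "\<And>i. 0 < i \<Longrightarrow> i < ?n \<Longrightarrow> N1 $$ (i,0) = 0"
      using clear_column[OF Nc col] by blast
    note N1c = mat_equiv_carrier(2)[OF N1(1)]
    \<comment> \<open>The top row kept here is the already cleared first column of
      \<open>N1\<close>, so the second clearing does not undo the first.\<close>
    obtain N2 where N2: "mat_equiv ?n (transpose_mat N1) N2"
        "\<And>j. j < ?n \<Longrightarrow> N2 $$ (0,j) = transpose_mat N1 $$ (0,j)"
        "\<And>i. 0 < i \<Longrightarrow> i < ?n \<Longrightarrow> N2 $$ (i,0) = 0"
      using clear_column[of "transpose_mat N1" ?n] N1c N1(2) row by auto
    note N2c = mat_equiv_carrier(2)[OF N2(1)]
    have "mat_equiv ?n M (transpose_mat N2)"
      using mat_equiv_trans[OF mat_equiv_trans[OF N(1) N1(1)]] mat_equiv_transpose[OF N2(1)] by simp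
    moreover have "transpose_mat N2 $$ (i,0) = 0 \<and> transpose_mat N2 $$ (0,i) = 0" if "0 < i" "i < ?n" for i
      using that N2 N1 N1c N2c by simp
    ultimately show ?thesis by blast
  qed
  then obtain N where N: "mat_equiv ?n M N"
    and z: "\<And>i. i < ?n \<Longrightarrow> 0 < i \<Longrightarrow> N $$ (i,0) = 0 \<and> N $$ (0,i) = 0" by blast
  note Nc = mat_equiv_carrier(2)[OF N]
  have "N = four_block_mat (mat 1 1 (\<lambda>_. N $$ (0,0))) (0\<^sub>m 1 n) (0\<^sub>m n 1) (mat n n (\<lambda>(i,j). N $$ (Suc i, Suc j)))"
    using Nc z by (intro eq_matI) auto
  then show thesis using that[of "mat 1 1 (\<lambda>_. N $$ (0,0))" "mat n n (\<lambda>(i,j). N $$ (Suc i, Suc j))"] N by auto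
qed

text \<open>Bordering the two multipliers with an identity block preserves their
  determinants.\<close>

lemma mat_equiv_four_block:
  fixes M :: "'a::idom mat"
  assumes d: "d \<in> carrier_mat m m" and e: "mat_equiv n M N"
  shows "mat_equiv (m + n) (four_block_mat d (0\<^sub>m m n) (0\<^sub>m n m) M)
    (four_block_mat d (0\<^sub>m m n) (0\<^sub>m n m) N)"
proof -
  from e obtain P Q where 1: "M \<in> carrier_mat n n" "P \<in> carrier_mat n n" "Q \<in> carrier_mat n n"
    "det P dvd 1" "det Q dvd 1" "N = P * M * Q" unfolding mat_equiv_def by blast
  define B where "B X = four_block_mat (1\<^sub>m m) (0\<^sub>m m n) (0\<^sub>m n m) X" for X :: "'a mat"
  have B: "B X \<in> carrier_mat (m + n) (m + n)" "det (B X) = det X" if "X \<in> carrier_mat n n" for X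
    using that det_four_block_mat_lower_left_zero[of "1\<^sub>m m" m "0\<^sub>m m n" n "0\<^sub>m n m" X]
    by (auto simp: B_def)
  have "B P * four_block_mat d (0\<^sub>m m n) (0\<^sub>m n m) M * B Q = four_block_mat d (0\<^sub>m m n) (0\<^sub>m n m) N"
    using 1 d unfolding B_def
    by (subst mult_four_block_mat[of _ m m _ n _ n _ _ m _ n]; simp?)+
  moreover have "four_block_mat d (0\<^sub>m m n) (0\<^sub>m n m) M \<in> carrier_mat (m + n) (m + n)" using 1 d by simp
  ultimately show ?thesis using mat_equivI[of _ "m + n" "B P" "B Q"] 1 B by metis
qed

text \<open>After splitting off a corner, transposition changes only the smaller block, because a
  \<open>1 \<times> 1\<close> block is symmetric. The chain runs from \<open>M\<close> to the block
  matrix, to its transpose by induction, and back along the transposed first equivalence.\<close>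

lemma mat_equiv_transpose_self:
  fixes M :: "int mat"
  assumes "M \<in> carrier_mat n n"
  shows "mat_equiv n M (transpose_mat M)"
  using assms
proof (induction n arbitrary: M)
  case 0
  then have "transpose_mat M = M" by (intro eq_matI) auto
  then show ?case using mat_equiv_refl[OF 0] by simp
next
  case (Suc n)
  obtain d M' where d: "d \<in> carrier_mat 1 1" and M': "M' \<in> carrier_mat n n"
    and e: "mat_equiv (Suc n) M (four_block_mat d (0\<^sub>m 1 n) (0\<^sub>m n 1) M')" (is "mat_equiv _ _ ?N")
    using mat_equiv_split_corner[OF Suc.prems] by blast
  have dt: "transpose_mat d = d" using d by (intro eq_matI) auto
  have "transpose_mat ?N = four_block_mat d (0\<^sub>m 1 n) (0\<^sub>m n 1) (transpose_mat M')"
    using transpose_four_block_mat[OF d _ _ M', of "0\<^sub>m 1 n" "0\<^sub>m n 1"] dt by simp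
  then have "mat_equiv (Suc n) ?N (transpose_mat ?N)"
    using mat_equiv_four_block[OF d Suc.IH[OF M']] by simp
  then show ?case
    using e mat_equiv_trans mat_equiv_sym mat_equiv_transpose by metis
qed

section \<open>Exterior powers of groups\<close>


context
  fixes G (structure)
  assumes G: "group G"
begin

lemma coset_ext_power_hom:
  "(\<lambda>c. ext_rel_group G r #>\<^bsub>free_Abelian_group (tuples G r)\<^esub> c)
     \<in> hom (free_Abelian_group (tuples G r)) (ext_power r G)"
  unfolding ext_power_def using normal.r_coset_hom_Mod[OF ext_rel_group_normal[OF G]] .

lemma coset_ext_power_group_hom:
  "group_hom (free_Abelian_group (tuples G r)) (ext_power r G)
     (\<lambda>c. ext_rel_group G r #>\<^bsub>free_Abelian_group (tuples G r)\<^esub> c)"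
  using coset_ext_power_hom comm_group_ext_power[OF G]
  by (intro group_hom.intro group_hom_axioms.intro) (auto simp: comm_group_def)

text \<open>The relations and the induction rule of the free group are written with subtraction;
  this translates it into the operations of the quotient.\<close>

lemma coset_ext_power_diff:
  assumes "c \<in> carrier (free_Abelian_group (tuples G r))" "d \<in> carrier (free_Abelian_group (tuples G r))"
  shows "ext_rel_group G r #>\<^bsub>free_Abelian_group (tuples G r)\<^esub> (c - d) =
    (ext_rel_group G r #>\<^bsub>free_Abelian_group (tuples G r)\<^esub> c) \<otimes>\<^bsub>ext_power r G\<^esub>
    inv\<^bsub>ext_power r G\<^esub> (ext_rel_group G r #>\<^bsub>free_Abelian_group (tuples G r)\<^esub> d)"
proof -
  interpret q: group_hom "free_Abelian_group (tuples G r)" "ext_power r G"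
    "\<lambda>c. ext_rel_group G r #>\<^bsub>free_Abelian_group (tuples G r)\<^esub> c"
    by (rule coset_ext_power_group_hom)
  have "c - d = c \<otimes>\<^bsub>free_Abelian_group (tuples G r)\<^esub> inv\<^bsub>free_Abelian_group (tuples G r)\<^esub> d"
    using assms(2) by simp
  then show ?thesis using assms by (simp only: q.hom_mult q.G.inv_closed q.hom_inv)
qed

lemma coset_ext_rel:
  assumes "c \<in> ext_rels G r"
  shows "ext_rel_group G r #>\<^bsub>free_Abelian_group (tuples G r)\<^esub> c = \<one>\<^bsub>ext_power r G\<^esub>"
proof -
  interpret N: normal "ext_rel_group G r" "free_Abelian_group (tuples G r)"
    by (rule ext_rel_group_normal[OF G])
  have "c \<in> ext_rel_group G r" using assms unfolding ext_rel_group_def by (rule generate.incl)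
  then show ?thesis using N.rcos_const[OF N.is_group] by (simp add: ext_power_def FactGroup_def)
qed

lemma tuples_update: "xs \<in> tuples G r \<Longrightarrow> x \<in> carrier G \<Longrightarrow> xs[i := x] \<in> tuples G r"
  using set_update_subset_insert[of xs i x] by (auto simp: tuples_def)

lemma wedge_coset:
  "xs \<in> tuples G r \<Longrightarrow>
     wedge G xs = ext_rel_group G r #>\<^bsub>free_Abelian_group (tuples G r)\<^esub> frag_of xs"
  by (simp add: wedge_def tuples_def)

lemma wedge_closed: "xs \<in> tuples G r \<Longrightarrow> wedge G xs \<in> carrier (ext_power r G)"
  using group_hom.hom_closed[OF coset_ext_power_group_hom, of "frag_of xs" r] by (simp add: wedge_coset)

lemma wedge_repeated:
  assumes "xs \<in> tuples G r" "i < j" "j < r" "xs ! i = xs ! j"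
  shows "wedge G xs = \<one>\<^bsub>ext_power r G\<^esub>"
proof -
  have "frag_of xs \<in> ext_rels G r" using assms unfolding ext_rels_def by blast
  then show ?thesis using coset_ext_rel wedge_coset[OF assms(1)] by simp
qed

lemma wedge_add:
  assumes xs: "xs \<in> tuples G r" and i: "i < r" and x: "x \<in> carrier G" and y: "y \<in> carrier G"
  shows "wedge G (xs[i := x \<otimes> y]) = wedge G (xs[i := x]) \<otimes>\<^bsub>ext_power r G\<^esub> wedge G (xs[i := y])"
proof -
  interpret G: group G by (rule G)
  interpret E: comm_group "ext_power r G" by (rule comm_group_ext_power[OF G])
  let ?F = "free_Abelian_group (tuples G r)"
  interpret F: comm_group ?F by (rule abelian_free_Abelian_group)
  define a b c where "a = frag_of (xs[i := x \<otimes> y])" and "b = frag_of (xs[i := x])"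
    and "c = frag_of (xs[i := y])"
  have abc: "a \<in> carrier ?F" "b \<in> carrier ?F" "c \<in> carrier ?F"
    using tuples_update[OF xs] x y unfolding a_def b_def c_def by simp_all
  have ab: "a - b \<in> carrier ?F"
    using F.m_closed[OF abc(1) F.inv_closed[OF abc(2)]] abc(2) by simp
  have rel: "a - b - c \<in> ext_rels G r"
    using xs i x y unfolding ext_rels_def a_def b_def c_def by blast
  let ?a = "wedge G (xs[i := x \<otimes> y])" and ?b = "wedge G (xs[i := x])" and ?c = "wedge G (xs[i := y])"
  have cl: "?a \<in> carrier (ext_power r G)" "?b \<in> carrier (ext_power r G)" "?c \<in> carrier (ext_power r G)"
    using wedge_closed tuples_update[OF xs] x y by simp_all
  have "?a \<otimes>\<^bsub>ext_power r G\<^esub> inv\<^bsub>ext_power r G\<^esub> ?b \<otimes>\<^bsub>ext_power r G\<^esub> inv\<^bsub>ext_power r G\<^esub> ?c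
      = \<one>\<^bsub>ext_power r G\<^esub>"
    using coset_ext_rel[OF rel] tuples_update[OF xs] x y
    unfolding coset_ext_power_diff[OF ab abc(3)] coset_ext_power_diff[OF abc(1,2)]
    unfolding a_def b_def c_def by (simp add: wedge_coset[of _ r])
  from E.inv_equality[OF this] have "?c = ?a \<otimes>\<^bsub>ext_power r G\<^esub> inv\<^bsub>ext_power r G\<^esub> ?b"
    using cl by simp
  then show ?thesis using cl by (simp add: E.m_comm E.inv_solve_right)
qed

text \<open>Induction over the free group above the quotient. Spanning is phrased through subgroups
  so that it can later be applied to equalizers.\<close>

lemma ext_power_minimal:
  assumes S: "subgroup S (ext_power r G)" and w: "\<And>xs. xs \<in> tuples G r \<Longrightarrow> wedge G xs \<in> S"
  shows "S = carrier (ext_power r G)"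
proof
  show "S \<subseteq> carrier (ext_power r G)" using subgroup.subset[OF S] .
  show "carrier (ext_power r G) \<subseteq> S"
  proof
    fix X assume "X \<in> carrier (ext_power r G)"
    then obtain c where c: "c \<in> carrier (free_Abelian_group (tuples G r))"
      and X: "X = ext_rel_group G r #>\<^bsub>free_Abelian_group (tuples G r)\<^esub> c"
      by (auto simp: ext_power_def FactGroup_def RCOSETS_def)
    have keys: "Poly_Mapping.keys c \<subseteq> tuples G r" using c by simp
    show "X \<in> S" unfolding X
    proof (induction rule: free_Abelian_group_induct[where x = c and S = "tuples G r"])
      case 1
      show ?case by (rule keys)
    next
      case 2
      show ?case using subgroup.one_closed[OF S] coset_ext_power_group_hom[of r] group_hom.hom_one by fastforce
    next
      case (3 x y)
      then show ?case
        using coset_ext_power_diff[of x r y] subgroup.m_closed[OF S] subgroup.m_inv_closed[OF S] by simp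
    next
      case (4 a)
      then show ?case using w wedge_coset by metis
    qed
  qed
qed

text \<open>The map extends to the free group, its two properties put the relations into the kernel,
  and so it factors through the quotient. This is the source of the determinant functionals.\<close>

lemma ext_power_universal:
  assumes M: "comm_group M"
    and cl: "\<And>xs. xs \<in> tuples G r \<Longrightarrow> \<omega> xs \<in> carrier M"
    and additive: "\<And>xs i x y. xs \<in> tuples G r \<Longrightarrow> i < r \<Longrightarrow> x \<in> carrier G \<Longrightarrow> y \<in> carrier G \<Longrightarrow>
      \<omega> (xs[i := x \<otimes> y]) = \<omega> (xs[i := x]) \<otimes>\<^bsub>M\<^esub> \<omega> (xs[i := y])"
    and alternating: "\<And>xs i j. xs \<in> tuples G r \<Longrightarrow> i < j \<Longrightarrow> j < r \<Longrightarrow> xs ! i = xs ! j \<Longrightarrow> \<omega> xs = \<one>\<^bsub>M\<^esub>"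
  obtains h where "h \<in> hom (ext_power r G) M" "\<And>xs. xs \<in> tuples G r \<Longrightarrow> h (wedge G xs) = \<omega> xs"
proof -
  let ?F = "free_Abelian_group (tuples G r)"
  interpret G: group G by (rule G)
  interpret M: comm_group M by (rule M)
  interpret F: comm_group ?F by (rule abelian_free_Abelian_group)
  obtain g where g: "g \<in> hom ?F M" "\<And>xs. xs \<in> tuples G r \<Longrightarrow> g (frag_of xs) = \<omega> xs"
    using M.free_Abelian_group_universal[of \<omega> "tuples G r"] cl by blast
  interpret g: group_hom ?F M g using g(1) by unfold_locales
  have "ext_rels G r \<subseteq> kernel ?F M g"
  proof
    fix c assume c: "c \<in> ext_rels G r"
    then consider
      (add) xs i x y where "c = frag_of (xs[i := x \<otimes> y]) - frag_of (xs[i := x]) - frag_of (xs[i := y])"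
        "xs \<in> tuples G r" "i < r" "x \<in> carrier G" "y \<in> carrier G"
      | (alt) xs i j where "c = frag_of xs" "xs \<in> tuples G r" "i < j" "j < r" "xs ! i = xs ! j"
      unfolding ext_rels_def by blast
    then have "g c = \<one>\<^bsub>M\<^esub>"
    proof cases
      case add
      let ?a = "frag_of (xs[i := x \<otimes> y])" and ?b = "frag_of (xs[i := x])" and ?c = "frag_of (xs[i := y])"
      have t: "xs[i := x \<otimes> y] \<in> tuples G r" "xs[i := x] \<in> tuples G r" "xs[i := y] \<in> tuples G r"
        using add tuples_update by auto
      have "c = ?a \<otimes>\<^bsub>?F\<^esub> inv\<^bsub>?F\<^esub> ?b \<otimes>\<^bsub>?F\<^esub> inv\<^bsub>?F\<^esub> ?c" using t add(1) by simp
      moreover have fc: "?a \<in> carrier ?F" "?b \<in> carrier ?F" "?c \<in> carrier ?F" using t by simp_all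
      ultimately have "g c = g ?a \<otimes>\<^bsub>M\<^esub> inv\<^bsub>M\<^esub> g ?b \<otimes>\<^bsub>M\<^esub> inv\<^bsub>M\<^esub> g ?c"
        by (simp only: g.hom_mult F.m_closed F.inv_closed g.hom_inv)
      also have "\<dots> = (\<omega> (xs[i := x]) \<otimes>\<^bsub>M\<^esub> \<omega> (xs[i := y])) \<otimes>\<^bsub>M\<^esub> inv\<^bsub>M\<^esub> \<omega> (xs[i := x]) \<otimes>\<^bsub>M\<^esub> inv\<^bsub>M\<^esub> \<omega> (xs[i := y])"
        using t g(2) additive[OF add(2-5)] by simp
      also have "\<dots> = \<one>\<^bsub>M\<^esub>" using cl[OF t(2)] cl[OF t(3)]
        by (simp add: M.m_comm[of "\<omega> (xs[i := x])"] M.m_assoc)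
      finally show ?thesis .
    next
      case alt
      then show ?thesis using alternating g(2) by simp
    qed
    then show "c \<in> kernel ?F M g" using c ext_rels_subset[OF G] unfolding kernel_def by blast
  qed
  then have "ext_rel_group G r \<subseteq> kernel ?F M g"
    unfolding ext_rel_group_def by (intro F.generate_subgroup_incl g.subgroup_kernel)
  then obtain h where "h \<in> hom (?F Mod ext_rel_group G r) M"
    "\<And>c. c \<in> carrier ?F \<Longrightarrow> h (ext_rel_group G r #>\<^bsub>?F\<^esub> c) = g c"
    using g.FactGroup_universal_kernel[OF ext_rel_group_normal[OF G]] by blast
  then show thesis using that[of h] g(2) by (simp add: ext_power_def wedge_coset)
qed

lemma wedge_one:
  assumes "xs \<in> tuples G r" "i < r"
  shows "wedge G (xs[i := \<one>]) = \<one>\<^bsub>ext_power r G\<^esub>"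
proof -
  interpret G: group G by (rule G)
  interpret E: comm_group "ext_power r G" by (rule comm_group_ext_power[OF G])
  have "wedge G (xs[i := \<one>]) \<in> carrier (ext_power r G)"
    using wedge_closed tuples_update assms by simp
  then show ?thesis using wedge_add[OF assms, of \<one> \<one>] by simp
qed

lemma wedge_inv:
  assumes "xs \<in> tuples G r" "i < r" "x \<in> carrier G"
  shows "wedge G (xs[i := inv x]) = inv\<^bsub>ext_power r G\<^esub> wedge G (xs[i := x])"
proof -
  interpret G: group G by (rule G)
  interpret E: comm_group "ext_power r G" by (rule comm_group_ext_power[OF G])
  have "wedge G (xs[i := inv x]) \<otimes>\<^bsub>ext_power r G\<^esub> wedge G (xs[i := x]) = \<one>\<^bsub>ext_power r G\<^esub>"
    using wedge_add[OF assms(1,2), of "inv x" x] wedge_one[OF assms(1,2)] assms(3) by simp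
  then show ?thesis
    using E.inv_equality wedge_closed tuples_update assms by simp
qed

text \<open>Polarisation: with \<open>xs ! i \<otimes> xs ! j\<close> in both slots the wedge is
  trivial. Expanding it, the two terms with equal entries vanish and the two mixed terms are inverse
  to each other.\<close>

lemma wedge_swap:
  assumes xs: "xs \<in> tuples G r" and ij: "i < r" "j < r" "i \<noteq> j"
  shows "wedge G (xs[i := xs ! j, j := xs ! i]) = inv\<^bsub>ext_power r G\<^esub> wedge G xs"
proof -
  interpret G: group G by (rule G)
  interpret E: comm_group "ext_power r G" by (rule comm_group_ext_power[OF G])
  define w where "w u v = wedge G (xs[i := u, j := v])" for u v
  let ?x = "xs ! i" and ?y = "xs ! j"
  have len: "length xs = r" and xy: "?x \<in> carrier G" "?y \<in> carrier G"
    using xs ij by (auto simp: tuples_def)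
  have cl: "w u v \<in> carrier (ext_power r G)" if "u \<in> carrier G" "v \<in> carrier G" for u v
    using that xs tuples_update wedge_closed unfolding w_def by metis
  have same: "w u u = \<one>\<^bsub>ext_power r G\<^esub>" if "u \<in> carrier G" for u
  proof -
    have "xs[i := u, j := u] \<in> tuples G r" "xs[i := u, j := u] ! i = u" "xs[i := u, j := u] ! j = u"
      using that xs ij len tuples_update by (simp_all add: nth_list_update)
    then show ?thesis unfolding w_def using wedge_repeated ij by (metis nat_neq_iff)
  qed
  have add2: "w u (v \<otimes> v') = w u v \<otimes>\<^bsub>ext_power r G\<^esub> w u v'"
    if "u \<in> carrier G" "v \<in> carrier G" "v' \<in> carrier G" for u v v'
    unfolding w_def using wedge_add[OF tuples_update[OF xs that(1)] ij(2) that(2,3)] .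
  have add1: "w (u \<otimes> u') v = w u v \<otimes>\<^bsub>ext_power r G\<^esub> w u' v"
    if "u \<in> carrier G" "u' \<in> carrier G" "v \<in> carrier G" for u u' v
    unfolding w_def list_update_swap[OF ij(3)]
    using wedge_add[OF tuples_update[OF xs that(3)] ij(1) that(1,2)] .
  have "\<one>\<^bsub>ext_power r G\<^esub> = w (?x \<otimes> ?y) (?x \<otimes> ?y)" using same xy by simp
  also have "\<dots> = w ?y ?x \<otimes>\<^bsub>ext_power r G\<^esub> w ?x ?y"
    using xy cl by (simp add: add1 add2 same[OF xy(1)] same[OF xy(2)] E.m_comm)
  finally have "w ?y ?x = inv\<^bsub>ext_power r G\<^esub> w ?x ?y" using cl xy E.inv_equality by metis
  then show ?thesis by (simp add: w_def)
qed

text \<open>Each transposition inverts the wedge, and \<open>S\<close> is closed under inverses, so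
  membership survives without tracking the sign.\<close>

lemma wedge_permute:
  assumes S: "subgroup S (ext_power r G)" and xs: "xs \<in> tuples G r" and w: "wedge G xs \<in> S"
    and p: "p permutes {..<r}"
  shows "wedge G (permute_list p xs) \<in> S"
proof -
  have fin: "finite {..<r}" by simp
  have len: "length xs = r" using xs by (simp add: tuples_def)
  show ?thesis using fin p
  proof (induction rule: permutes_rev_induct)
    case id
    then show ?case using w by simp
  next
    case (swap a b p)
    let ?ys = "permute_list p xs"
    have p: "p permutes {..<length xs}" and ab: "a < r" "b < r" "a \<noteq> b" and IH: "wedge G ?ys \<in> S"
      using swap len by auto
    have ys: "?ys \<in> tuples G r" "length ?ys = r"
      using xs p by (simp_all add: tuples_def)
    have t: "Transposition.transpose a b permutes {..<length xs}"
      using ab len by (intro permutes_swap_id) auto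
    have "permute_list (p \<circ> Transposition.transpose a b) xs = permute_list (Transposition.transpose a b) ?ys"
      using p t by (intro permute_list_compose) auto
    also have "\<dots> = ?ys[a := ?ys ! b, b := ?ys ! a]"
      using ys ab len t
      by (intro nth_equalityI) (auto simp: permute_list_nth nth_list_update Transposition.transpose_def)
    finally have "permute_list (p \<circ> Transposition.transpose a b) xs = ?ys[a := ?ys ! b, b := ?ys ! a]" .
    then show ?case
      using wedge_swap[OF ys(1) ab] subgroup.m_inv_closed[OF S IH] by metis
  qed
qed

lemma ext_power_minimal_generators:
  assumes S: "subgroup S (ext_power r G)" and B: "B \<subseteq> carrier G" "carrier G = generate G B"
    and w: "\<And>xs. length xs = r \<Longrightarrow> set xs \<subseteq> B \<Longrightarrow> wedge G xs \<in> S"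
  shows "S = carrier (ext_power r G)"
proof (rule ext_power_minimal[OF S])
  interpret G: group G by (rule G)
  \<comment> \<open>The first \<open>k\<close> slots are arbitrary and the others lie in
    \<open>B\<close>: \<open>k = 0\<close> is the hypothesis, \<open>k = r\<close> the goal. In the
    step, slot \<open>k\<close> is freed by induction over \<open>generate G B\<close>.\<close>
  have "wedge G xs \<in> S" if "xs \<in> tuples G r" "\<And>i. k \<le> i \<Longrightarrow> i < r \<Longrightarrow> xs ! i \<in> B" for k xs
    using that
  proof (induction k arbitrary: xs)
    case 0
    then have "length xs = r" "set xs \<subseteq> B" by (auto simp: tuples_def in_set_conv_nth)
    then show ?case by (rule w)
  next
    case (Suc k)
    show ?case
    proof (cases "k < r")
      case False
      then show ?thesis using Suc by simp
    next
      case True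
      have len: "length xs = r" and k: "xs ! k \<in> carrier G" using Suc.prems(1) True by (auto simp: tuples_def)
      have "wedge G (xs[k := v]) \<in> S" if "v \<in> generate G B" for v
        using that
      proof (induction rule: generate.induct)
        case one
        then show ?case using wedge_one[OF Suc.prems(1) True] subgroup.one_closed[OF S] by simp
      next
        case (incl h)
        then show ?case using B Suc.prems True len
          by (intro Suc.IH tuples_update) (auto simp: nth_list_update)
      next
        case (inv h)
        have "wedge G (xs[k := h]) \<in> S" using inv B Suc.prems True len
          by (intro Suc.IH tuples_update) (auto simp: nth_list_update)
        then show ?case
          using wedge_inv[OF Suc.prems(1) True, of h] inv B subgroup.m_inv_closed[OF S] by auto
      next
        case (eng h1 h2)
        then show ?case
          using wedge_add[OF Suc.prems(1) True, of h1 h2] B subgroup.m_closed[OF S] by simp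
      qed
      then have "wedge G (xs[k := xs ! k]) \<in> S" using k B by blast
      then show ?thesis by simp
    qed
  qed
  from this[of _ r] show "wedge G xs \<in> S" if "xs \<in> tuples G r" for xs using that by simp
qed

end

section \<open>Coordinates and equivalence of endomorphisms\<close>


lemma subgroup_equalizer:
  assumes "group G" "group H" "h \<in> hom G H" "h' \<in> hom G H"
  shows "subgroup {x \<in> carrier G. h x = h' x} G"
proof -
  interpret h: group_hom G H h using assms by (simp add: group_hom_def group_hom_axioms_def)
  interpret h': group_hom G H h' using assms by (simp add: group_hom_def group_hom_axioms_def)
  show ?thesis by unfold_locales auto
qed

lemma Zpow_simps [simp]:
  "carrier (Zpow m) = carrier_vec m" "x \<otimes>\<^bsub>Zpow m\<^esub> y = x + y" "\<one>\<^bsub>Zpow m\<^esub> = 0\<^sub>v m"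
  by (simp_all add: monoid_vec_simps)

lemma inv_Zpow [simp]:
  assumes "v \<in> carrier_vec m"
  shows "inv\<^bsub>Zpow m\<^esub> v = - v"
proof -
  interpret comm_group "Zpow m" by (rule comm_group_vec)
  show ?thesis using assms inv_equality[of "- v" v] by simp
qed

lemma mult_mat_vec_hom_Zpow: "A \<in> carrier_mat m m \<Longrightarrow> (*\<^sub>v) A \<in> hom (Zpow m) (Zpow m)"
  by (intro homI) (simp_all add: mult_add_distrib_mat_vec[of _ m m])

lemma mult_mat_vec_iso_Zpow:
  fixes U :: "int mat"
  assumes "U \<in> carrier_mat m m" "det U dvd 1"
  shows "(*\<^sub>v) U \<in> iso (Zpow m) (Zpow m)"
proof -
  obtain U' where U': "U' \<in> carrier_mat m m" "U * U' = 1\<^sub>m m" "U' * U = 1\<^sub>m m"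
    using is_unit_detE[OF assms] by blast
  have "U' *\<^sub>v (U *\<^sub>v v) = v" "U *\<^sub>v (U' *\<^sub>v v) = v" if "v \<in> carrier_vec m" for v
    using that assms(1) U'
    by (simp_all flip: assoc_mult_mat_vec[of _ m m _ m])
  then have "bij_betw ((*\<^sub>v) U) (carrier_vec m) (carrier_vec m)"
    using assms(1) U'(1) by (intro bij_betw_byWitness[where f' = "(*\<^sub>v) U'"]) auto
  then show ?thesis using mult_mat_vec_hom_Zpow[OF assms(1)] by (simp add: iso_def)
qed

lemma subgroup_Zpow_unit_vecs:
  assumes S: "subgroup S (Zpow m)" and u: "\<And>k. k < m \<Longrightarrow> unit_vec m k \<in> S"
  shows "S = carrier (Zpow m)"
proof
  show "S \<subseteq> carrier (Zpow m)" using subgroup.subset[OF S] .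
  have add: "v + w \<in> S" if "v \<in> S" "w \<in> S" for v w using subgroup.m_closed[OF S] that by simp
  have neg: "- v \<in> S" if "v \<in> S" for v
    using subgroup.m_inv_closed[OF S that] subgroup.subset[OF S] that by auto
  have zero: "0\<^sub>v m \<in> S" using subgroup.one_closed[OF S] by simp
  have scaled: "c \<cdot>\<^sub>v unit_vec m k \<in> S" if k: "k < m" for c k
  proof (induction c rule: int_induct[where k = 0])
    case base
    have "0 \<cdot>\<^sub>v unit_vec m k = (0\<^sub>v m :: int vec)" by auto
    then show ?case using zero by simp
  next
    case (step1 i)
    have "(i + 1) \<cdot>\<^sub>v unit_vec m k = i \<cdot>\<^sub>v unit_vec m k + unit_vec m k"
      by (intro eq_vecI) (auto simp: algebra_simps)
    then show ?case using add step1(2) u[OF k] by simp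
  next
    case (step2 i)
    have "(i - 1) \<cdot>\<^sub>v unit_vec m k = i \<cdot>\<^sub>v unit_vec m k + - unit_vec m k"
      by (intro eq_vecI) (auto simp: algebra_simps)
    then show ?case using add step2(2) neg[OF u[OF k]] by simp
  qed
  show "carrier (Zpow m) \<subseteq> S"
  proof
    fix v assume "v \<in> carrier (Zpow m)"
    then have v: "v \<in> carrier_vec m" by simp
    \<comment> \<open>Truncations to the first \<open>k\<close> coordinates lead from zero to
      \<open>v\<close>, adding one scaled unit vector at a time.\<close>
    have "vec m (\<lambda>i. if i < k then v $ i else 0) \<in> S" if "k \<le> m" for k
      using that
    proof (induction k)
      case 0
      have "vec m (\<lambda>i. if i < 0 then v $ i else 0) = 0\<^sub>v m" by auto
      then show ?case using zero by simp
    next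
      case (Suc k)
      have "vec m (\<lambda>i. if i < Suc k then v $ i else 0)
        = vec m (\<lambda>i. if i < k then v $ i else 0) + v $ k \<cdot>\<^sub>v unit_vec m k"
        using Suc.prems by (intro eq_vecI) (auto simp: less_Suc_eq)
      then show ?case using add scaled Suc by simp
    qed
    moreover have "vec m (\<lambda>i. if i < m then v $ i else 0) = v" using v by auto
    ultimately show "v \<in> S" by fastforce
  qed
qed

lemma generate_unit_vecs: "carrier (Zpow m) = generate (Zpow m) (unit_vec m ` {..<m})"
proof -
  interpret comm_group "Zpow m" by (rule comm_group_vec)
  have "unit_vec m ` {..<m} \<subseteq> carrier (Zpow m)" by auto
  then have "subgroup (generate (Zpow m) (unit_vec m ` {..<m})) (Zpow m)" by (rule generate_is_subgroup)
  from subgroup_Zpow_unit_vecs[OF this] show ?thesis by (simp add: generate.incl)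
qed

text \<open>The functionals \<open>f\<close> are dual to the generators \<open>b\<close> only up to the signs \<open>s\<close>.\<close>

locale signed_dual_basis = comm_group G for G (structure) +
  fixes K :: nat and b :: "nat \<Rightarrow> 'a" and f :: "nat \<Rightarrow> 'a \<Rightarrow> int" and s :: "nat \<Rightarrow> int"
  assumes b_closed: "k < K \<Longrightarrow> b k \<in> carrier G"
    and f_hom: "k < K \<Longrightarrow> f k \<in> hom G integer_group"
    and f_b: "k < K \<Longrightarrow> l < K \<Longrightarrow> f k (b l) = (if k = l then s k else 0)"
    and s_square: "k < K \<Longrightarrow> s k * s k = 1"
    and b_spans: "subgroup S G \<Longrightarrow> (\<And>k. k < K \<Longrightarrow> b k \<in> S) \<Longrightarrow> S = carrier G"
begin

text \<open>Coordinates in the basis \<open>b k [^] s k\<close>, to which the \<open>f k\<close> are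
  exactly dual.\<close>

definition coords :: "'a \<Rightarrow> int vec" where
  "coords x = vec K (\<lambda>k. f k x)"

text \<open>The equalizer of two homomorphisms is a subgroup; once it contains every
  \<open>b k\<close>, spanning makes it all of \<open>G\<close>.\<close>

lemma hom_eqI:
  assumes "group H" "h \<in> hom G H" "h' \<in> hom G H" "\<And>k. k < K \<Longrightarrow> h (b k) = h' (b k)" "x \<in> carrier G"
  shows "h x = h' x"
  using b_spans[OF subgroup_equalizer[OF is_group assms(1-3)]] assms(4,5) b_closed by blast

lemma f_mult: "k < K \<Longrightarrow> x \<in> carrier G \<Longrightarrow> y \<in> carrier G \<Longrightarrow> f k (x \<otimes> y) = f k x + f k y"
  using hom_mult[OF f_hom, of k x y] by simp

text \<open>Both sides are homomorphisms in \<open>x\<close>, so comparison at \<open>b l\<close>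
  suffices. There the factor \<open>s l\<close> turns \<open>f l (b l) = s l\<close> into
  \<open>1\<close>.\<close>

lemma functional_expansion:
  assumes h: "h \<in> hom G integer_group" and x: "x \<in> carrier G"
  shows "h x = (\<Sum>k<K. s k * f k x * h (b k))"
proof (rule hom_eqI[OF group_integer_group h _ _ x])
  show "(\<lambda>x. \<Sum>k<K. s k * f k x * h (b k)) \<in> hom G integer_group"
    by (intro homI) (auto simp: f_mult algebra_simps sum.distrib)
  fix l assume l: "l < K"
  have "(\<Sum>k<K. s k * f k (b l) * h (b k)) = (\<Sum>k<K. if k = l then h (b l) else 0)"
    using l by (intro sum.cong) (auto simp: f_b s_square)
  then show "h (b l) = (\<Sum>k<K. s k * f k (b l) * h (b k))" using l by simp
qed

lemma coords_hom: "coords \<in> hom G (Zpow K)"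
  by (intro homI) (auto simp: coords_def f_mult)

lemma coords_iso: "coords \<in> iso G (Zpow K)"
proof -
  interpret c: group_hom G "Zpow K" coords
    using coords_hom comm_group_vec[of K, where 'a = int]
    by (simp add: group_hom_def group_hom_axioms_def comm_group_def)
  \<comment> \<open>\<open>t\<close> reassembles \<open>x\<close> from its coordinates; it fixes the generators, so it is the identity.\<close>
  define t where "t x = (\<Otimes>k\<in>{..<K}. b k [^] (s k * f k x))" for x
  have t: "t \<in> hom G G"
  proof (rule homI)
    show "t x \<in> carrier G" for x using b_closed by (auto simp: t_def)
    fix x y assume "x \<in> carrier G" "y \<in> carrier G"
    then have "t (x \<otimes> y) = (\<Otimes>k\<in>{..<K}. b k [^] (s k * f k x) \<otimes> b k [^] (s k * f k y))"
      unfolding t_def using b_closed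
      by (intro finprod_cong') (auto simp: f_mult distrib_left int_pow_mult)
    then show "t (x \<otimes> y) = t x \<otimes> t y"
      using b_closed by (simp add: t_def Pi_def)
  qed
  have tb: "t (b l) = b l" if l: "l < K" for l
  proof -
    have "t (b l) = (\<Otimes>k\<in>{..<K}. if l = k then b k else \<one>)"
      unfolding t_def using l b_closed
      by (intro finprod_cong') (auto simp: f_b s_square)
    then show ?thesis using l b_closed by (simp add: finprod_singleton)
  qed
  have id: "t x = x" if "x \<in> carrier G" for x
    using hom_eqI[OF is_group t, of "\<lambda>x. x"] tb that by (simp add: hom_def)
  have "inj_on coords (carrier G)"
  proof (rule inj_onI)
    fix x y assume xy: "x \<in> carrier G" "y \<in> carrier G" and eq: "coords x = coords y"
    have "f k x = f k y" if "k < K" for k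
      using arg_cong[OF eq, of "\<lambda>v. v $ k"] that by (simp add: coords_def)
    then have "t x = t y" unfolding t_def using b_closed by (intro finprod_cong') auto
    then show "x = y" using id xy by simp
  qed
  moreover have "coords ` carrier G = carrier (Zpow K)"
  proof (rule subgroup_Zpow_unit_vecs)
    show "subgroup (coords ` carrier G) (Zpow K)" by (rule c.img_is_subgroup)
    fix l assume l: "l < K"
    have "unit_vec K l = coords (b l [^] s l)"
    proof (intro eq_vecI)
      fix k assume "k < dim_vec (coords (b l [^] s l))"
      then have k: "k < K" by (simp add: coords_def)
      interpret fk: group_hom G integer_group "f k"
        using f_hom[OF k] by (simp add: group_hom_def group_hom_axioms_def)
      have "f k (b l [^] s l) = s l * f k (b l)"
        using fk.hom_int_pow[OF b_closed[OF l]] by simp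
      then show "unit_vec K l $ k = coords (b l [^] s l) $ k"
        using k l by (auto simp: coords_def f_b s_square)
    qed (simp add: coords_def)
    then show "unit_vec K l \<in> coords ` carrier G" using b_closed[OF l] by simp
  qed
  ultimately show ?thesis using coords_hom by (simp add: iso_iff)
qed

text \<open>Column \<open>l\<close> describes the image of \<open>b l [^] s l\<close>, whence the
  factor \<open>s l\<close>: this is the matrix in the basis behind \<open>coords\<close>.\<close>

definition coord_mat :: "('a \<Rightarrow> 'a) \<Rightarrow> int mat" where
  "coord_mat h = mat K K (\<lambda>(k, l). f k (h (b l)) * s l)"

lemma coord_mat_carrier [simp]: "coord_mat h \<in> carrier_mat K K"
  by (simp add: coord_mat_def)

lemma coords_endo:
  assumes h: "h \<in> hom G G" and x: "x \<in> carrier G"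
  shows "coords (h x) = coord_mat h *\<^sub>v coords x"
proof (intro eq_vecI)
  fix k assume "k < dim_vec (coord_mat h *\<^sub>v coords x)"
  then have k: "k < K" by (simp add: coord_mat_def)
  have "f k \<circ> h \<in> hom G integer_group" by (rule Group.hom_compose[OF h f_hom[OF k]])
  from functional_expansion[OF this x] show "coords (h x) $ k = (coord_mat h *\<^sub>v coords x) $ k"
    using k by (simp add: coords_def coord_mat_def scalar_prod_def lessThan_atLeast0 mult_ac)
qed (simp add: coords_def coord_mat_def)

lemma coords_minus_id:
  assumes h: "h \<in> hom G G" and x: "x \<in> carrier G"
  shows "coords (minus_id G h x) = (coord_mat h - 1\<^sub>m K) *\<^sub>v coords x"
proof -
  interpret c: group_hom G "Zpow K" coords
    using coords_hom comm_group_vec[of K, where 'a = int]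
    by (simp add: group_hom_def group_hom_axioms_def comm_group_def)
  have hx: "h x \<in> carrier G" using h x by (auto simp: hom_def)
  have [simp]: "coords y \<in> carrier_vec K" for y by (simp add: coords_def)
  have "coords (minus_id G h x) = coords (h x) + - coords x"
    using c.hom_mult[OF hx inv_closed[OF x]] c.hom_inv[OF x] by (simp add: minus_id_def)
  also have "\<dots> = coord_mat h *\<^sub>v coords x - coords x"
    using coords_endo[OF h x] by (auto simp: minus_add_uminus_vec[of _ K])
  finally show ?thesis by (simp add: minus_mult_distrib_mat_vec[of _ K K])
qed

end

text \<open>Unlike \<open>equivalent_endos\<close>, this compares endomorphisms of two different
  groups, as needed for two exterior powers before any bases are chosen. Source and target are
  identified independently.\<close>

definition endos_equiv ::
  "('a, 'b) monoid_scheme \<Rightarrow> ('c, 'd) monoid_scheme \<Rightarrow> ('a \<Rightarrow> 'a) \<Rightarrow> ('c \<Rightarrow> 'c) \<Rightarrow> bool" where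
  "endos_equiv G H f g \<longleftrightarrow>
     (\<exists>\<alpha>\<in>iso G H. \<exists>\<beta>\<in>iso G H. \<forall>x\<in>carrier G. \<alpha> (f x) = g (\<beta> x))"

lemma endos_equiv_coker:
  assumes G: "comm_group G" and H: "comm_group H" and f: "f \<in> hom G G" and g: "g \<in> hom H H"
    and e: "endos_equiv G H f g"
  shows "coker G f \<cong> coker H g"
proof -
  interpret G: comm_group G by (rule G)
  interpret H: comm_group H by (rule H)
  interpret f: group_hom G G f using f by unfold_locales
  interpret g: group_hom H H g using g by unfold_locales
  obtain \<alpha> \<beta> where \<alpha>: "\<alpha> \<in> iso G H" and \<beta>: "\<beta> \<in> iso G H" and eq: "\<And>x. x \<in> carrier G \<Longrightarrow> \<alpha> (f x) = g (\<beta> x)"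
    using e unfolding endos_equiv_def by blast
  let ?N = "g ` carrier H"
  have N: "?N \<lhd> H" by (intro H.subgroup_imp_normal g.img_is_subgroup)
  interpret N: normal ?N H by (rule N)
  define q where "q x = ?N #>\<^bsub>H\<^esub> \<alpha> x" for x
  have "q = (\<lambda>y. ?N #>\<^bsub>H\<^esub> y) \<circ> \<alpha>" by (auto simp: q_def)
  then have "q \<in> hom G (H Mod ?N)"
    using hom_compose[OF iso_imp_homomorphism[OF \<alpha>] N.r_coset_hom_Mod] by simp
  then interpret q: group_hom G "H Mod ?N" q
    using N.factorgroup_is_group by (simp add: group_hom_def group_hom_axioms_def)
  have bij: "\<alpha> ` carrier G = carrier H" "inj_on \<alpha> (carrier G)" "\<beta> ` carrier G = carrier H"
    using \<alpha> \<beta> by (auto simp: iso_iff)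
  have "kernel G (H Mod ?N) q = f ` carrier G"
  proof (intro equalityI subsetI)
    fix x assume "x \<in> kernel G (H Mod ?N) q"
    then have x: "x \<in> carrier G" and "?N #>\<^bsub>H\<^esub> \<alpha> x = ?N" by (auto simp: kernel_def q_def FactGroup_def)
    then have "\<alpha> x \<in> ?N" using H.rcos_self[of "\<alpha> x" ?N] bij(1) N.subgroup_axioms by blast
    then have "\<alpha> x \<in> g ` \<beta> ` carrier G" using bij(3) by simp
    then obtain y where y: "y \<in> carrier G" "\<alpha> x = g (\<beta> y)" by auto
    then have "\<alpha> x = \<alpha> (f y)" using eq by simp
    then have "x = f y" using bij(2) x y by (simp add: inj_on_eq_iff)
    then show "x \<in> f ` carrier G" using y by blast
  next
    fix x assume "x \<in> f ` carrier G"
    then obtain y where y: "y \<in> carrier G" "x = f y" by blast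
    then have "\<alpha> x \<in> ?N" using eq bij(3) by auto
    then show "x \<in> kernel G (H Mod ?N) q"
      using y N.rcos_const[OF H.is_group] by (auto simp: kernel_def q_def FactGroup_def)
  qed
  moreover have "q ` carrier G = carrier (H Mod ?N)"
  proof -
    have "q ` carrier G = (\<lambda>y. ?N #>\<^bsub>H\<^esub> y) ` \<alpha> ` carrier G" by (simp add: q_def image_image)
    then show ?thesis unfolding bij(1) by (simp add: carrier_FactGroup)
  qed
  ultimately show ?thesis using q.FactGroup_iso unfolding coker_def by simp
qed

text \<open>Since \<open>\<beta>\<close> stands on the side of \<open>g\<close>, its inverse enters
  \<open>v\<close>, while \<open>\<alpha>\<close> enters \<open>u\<close>; the chosen bases cancel
  in the middle.\<close>

lemma endos_equiv_transport:
  assumes G: "group G" and H: "group H" and f: "f \<in> hom G G" and g: "g \<in> hom H H"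
    and e: "endos_equiv G H f g" and \<phi>: "\<phi> \<in> iso G L" and \<psi>: "\<psi> \<in> iso H L"
  shows "equivalent_endos L (transport G \<phi> f) (transport H \<psi> g)"
proof -
  obtain \<alpha> \<beta> where \<alpha>: "\<alpha> \<in> iso G H" and \<beta>: "\<beta> \<in> iso G H" and eq: "\<And>x. x \<in> carrier G \<Longrightarrow> \<alpha> (f x) = g (\<beta> x)"
    using e unfolding endos_equiv_def by blast
  let ?i\<phi> = "inv_into (carrier G) \<phi>" and ?i\<psi> = "inv_into (carrier H) \<psi>" and ?i\<beta> = "inv_into (carrier G) \<beta>"
  define u where "u = \<psi> \<circ> (\<alpha> \<circ> ?i\<phi>)"
  define v where "v = \<phi> \<circ> (?i\<beta> \<circ> ?i\<psi>)"
  have "u \<in> iso L L" unfolding u_def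
    by (intro iso_set_trans[OF iso_set_trans[OF group.iso_set_sym[OF G \<phi>] \<alpha>] \<psi>])
  moreover have "v \<in> iso L L" unfolding v_def
    by (intro iso_set_trans[OF iso_set_trans[OF group.iso_set_sym[OF H \<psi>] group.iso_set_sym[OF G \<beta>]] \<phi>])
  moreover have "u (transport G \<phi> f (v x)) = transport H \<psi> g x" if x: "x \<in> carrier L" for x
  proof -
    have y: "?i\<psi> x \<in> carrier H" using x \<psi> by (auto simp: iso_iff intro: inv_into_into)
    then have z: "?i\<beta> (?i\<psi> x) \<in> carrier G" "\<beta> (?i\<beta> (?i\<psi> x)) = ?i\<psi> x"
      using \<beta> by (auto simp: iso_iff intro: inv_into_into f_inv_into_f)
    have "f (?i\<beta> (?i\<psi> x)) \<in> carrier G" using z f by (auto simp: hom_def)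
    then show ?thesis using z \<phi> eq[OF z(1)] by (simp add: u_def v_def transport_def iso_iff)
  qed
  ultimately show ?thesis unfolding equivalent_endos_def by blast
qed

section \<open>The determinant pairing\<close>


text \<open>\<open>S\<close> is the Gram matrix of a pairing preserved by \<open>B\<close> and
  \<open>C\<close> jointly, so the inverse of \<open>C\<close> is \<open>transpose_mat B\<close>
  conjugated by \<open>S\<close>. Factoring \<open>C\<close> out of \<open>C - 1\<^sub>m m\<close>
  then leaves \<open>1\<^sub>m m - transpose_mat B\<close>.\<close>

lemma mat_equiv_dual:
  fixes B C S :: "int mat"
  assumes B: "B \<in> carrier_mat m m" and C: "C \<in> carrier_mat m m" and S: "S \<in> carrier_mat m m"
    and SS: "S * S = 1\<^sub>m m" and inv: "transpose_mat B * (S * C) = S"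
  shows "mat_equiv m (B - 1\<^sub>m m) (C - 1\<^sub>m m)"
proof -
  note ass = assoc_mult_mat[of _ m m _ m _ m]
  let ?Bt = "transpose_mat B"
  have Bt: "?Bt \<in> carrier_mat m m" using B by simp
  have "det S * det S = 1" using det_mult[OF S S] SS by simp
  then have uS: "det S dvd 1" by (metis dvd_triv_right)
  \<comment> \<open>Hypothesis \<open>inv\<close> says that \<open>X\<close> is a left inverse of
    \<open>C\<close>; the determinants upgrade it to a two-sided one.\<close>
  define X where "X = S * (?Bt * S)"
  have X: "X \<in> carrier_mat m m" using S Bt by (simp add: X_def)
  have XC: "X * C = 1\<^sub>m m" using S Bt C inv SS by (simp add: X_def ass)
  have "det X * det C = 1" using det_mult[OF X C] XC by simp
  then have uC: "det C dvd 1" by (metis dvd_triv_right)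
  obtain C' where C': "C' \<in> carrier_mat m m" "C * C' = 1\<^sub>m m" using is_unit_detE[OF C uC] by blast
  have "X = X * (C * C')" using X C' by simp
  also have "\<dots> = (X * C) * C'" using X C C' by (simp add: ass)
  also have "\<dots> = C'" using XC C' by simp
  finally have CX: "C * X = 1\<^sub>m m" using C' by simp
  let ?M = "1\<^sub>m m - ?Bt"
  have "(C * S) * ?M * S = C * (S * S) - C * X"
    using B C S Bt X
    by (simp add: X_def ass minus_mult_distrib_mat[of _ m m _ _ m] mult_minus_distrib_mat[of _ m m _ m])
  then have C1: "C - 1\<^sub>m m = (C * S) * ?M * S" using C SS CX by simp
  have M: "?M \<in> carrier_mat m m" and CS: "C * S \<in> carrier_mat m m"
    by (intro minus_carrier_mat mult_carrier_mat[of _ m m _ m] Bt C S)+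
  have uCS: "det (C * S) dvd 1" unfolding det_mult[OF C S] using uC uS by (simp only: is_unit_mult_iff simp_thms)
  have e3: "mat_equiv m ?M (C - 1\<^sub>m m)" unfolding C1 by (rule mat_equivI[OF M CS S uCS uS])
  have "mat_equiv m (?Bt - 1\<^sub>m m) (((-1) \<cdot>\<^sub>m 1\<^sub>m m) * (?Bt - 1\<^sub>m m))"
    using Bt by (intro mat_equiv_left) (auto simp: minus_one_power_iff)
  also have "((-1) \<cdot>\<^sub>m 1\<^sub>m m) * (?Bt - 1\<^sub>m m) = ?M"
    using Bt by (subst mult_smult_assoc_mat[of _ m m _ m]) auto
  finally have e2: "mat_equiv m (?Bt - 1\<^sub>m m) ?M" .
  have "transpose_mat (B - 1\<^sub>m m) = ?Bt - 1\<^sub>m m" using B by (simp add: transpose_minus[of _ m m])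
  then have e1: "mat_equiv m (B - 1\<^sub>m m) (?Bt - 1\<^sub>m m)"
    using mat_equiv_transpose_self[of "B - 1\<^sub>m m" m] by (simp add: minus_carrier_mat)
  show ?thesis using mat_equiv_trans[OF mat_equiv_trans[OF e1 e2] e3] .
qed

section \<open>Determinants of matrices given by their rows\<close>

lemma det_mat_of_rows_add:
  fixes x y :: "'a::comm_ring_1 vec"
  assumes zs: "length zs = n" "set zs \<subseteq> carrier_vec n" and i: "i < n"
    and x: "x \<in> carrier_vec n" and y: "y \<in> carrier_vec n"
  shows "det (mat_of_rows n (zs[i := x + y])) =
    det (mat_of_rows n (zs[i := x])) + det (mat_of_rows n (zs[i := y]))"
proof -
  have upd: "mat_of_rows n (zs[i := v]) = mat\<^sub>r n n (\<lambda>k. if k = i then v else zs ! k)" for v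
    using zs(1) i by (intro eq_matI) (auto simp: mat_of_rows_def nth_list_update)
  have "(!) zs \<in> {0..<n} \<rightarrow> carrier_vec n" using zs by auto
  then show ?thesis unfolding upd
    using det_row_add[of "\<lambda>_. x" i n "\<lambda>_. y" "(!) zs"] x y i by simp
qed

lemma det_mat_of_rows_repeated:
  assumes "length zs = n" "set zs \<subseteq> carrier_vec n" "i < j" "j < n" "zs ! i = zs ! j"
  shows "det (mat_of_rows n zs) = 0"
proof (rule det_identical_rows)
  show "mat_of_rows n zs \<in> carrier_mat n n" using assms(1) mat_of_rows_carrier(1)[of n zs] by simp
  have "zs ! i \<in> carrier_vec n" "zs ! j \<in> carrier_vec n" using assms by (auto simp: subset_iff)
  then show "row (mat_of_rows n zs) i = row (mat_of_rows n zs) j" using assms by simp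
qed (use assms in auto)

text \<open>Applying \<open>A\<close> to every row is multiplication by
  \<open>transpose_mat A\<close> on the right. For determinant one this is the invariance of the
  pairing.\<close>

lemma det_mat_of_rows_mult:
  fixes A :: "'a::comm_ring_1 mat"
  assumes A: "A \<in> carrier_mat n n" and zs: "length zs = n" "set zs \<subseteq> carrier_vec n"
  shows "det (mat_of_rows n (map ((*\<^sub>v) A) zs)) = det A * det (mat_of_rows n zs)"
proof -
  have c: "mat_of_rows n zs \<in> carrier_mat n n" using zs mat_of_rows_carrier(1)[of n zs] by simp
  have "mat_of_rows n (map ((*\<^sub>v) A) zs) = mat_of_rows n zs * transpose_mat A"
  proof (intro eq_matI)
    fix i j assume "i < dim_row (mat_of_rows n zs * transpose_mat A)" "j < dim_col (mat_of_rows n zs * transpose_mat A)"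
    then have ij: "i < n" "j < n" using A zs by auto
    have "zs ! i \<in> carrier_vec n" using ij zs by auto
    then show "mat_of_rows n (map ((*\<^sub>v) A) zs) $$ (i, j) = (mat_of_rows n zs * transpose_mat A) $$ (i, j)"
      using ij A zs by (simp add: mat_of_rows_def[of n "map _ _"] comm_scalar_prod[of _ n])
  qed (use A zs in auto)
  then show ?thesis using det_mult[OF c, of "transpose_mat A"] A det_transpose[OF A] by (simp add: mult.commute)
qed

text \<open>The rows are orthonormal, so the matrix times its transpose is the identity.\<close>

lemma det_mat_of_rows_unit_vecs:
  assumes d: "distinct is" "length is = n" "set is \<subseteq> {..<n}"
  shows "det (mat_of_rows n (map (unit_vec n) is)) * det (mat_of_rows n (map (unit_vec n) is)) = (1 :: 'a::comm_ring_1)"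
proof -
  let ?M = "mat_of_rows n (map (unit_vec n) is) :: 'a mat"
  have M: "?M \<in> carrier_mat n n" using d mat_of_rows_carrier(1)[of n "map (unit_vec n) is"] by simp
  have "?M * transpose_mat ?M = 1\<^sub>m n"
  proof (intro eq_matI)
    fix i j assume "i < dim_row (1\<^sub>m n)" "j < dim_col (1\<^sub>m n)"
    then have ij: "i < n" "j < n" by auto
    then have "is ! i < n" "is ! j < n" using d nth_mem[of _ "is"] by blast+
    then show "(?M * transpose_mat ?M) $$ (i, j) = 1\<^sub>m n $$ (i, j)"
      using ij d by (simp add: nth_eq_iff_index_eq)
  qed (use d in auto)
  then show ?thesis using det_mult[OF M, of "transpose_mat ?M"] M det_transpose[OF M] by simp
qed

section \<open>Functionals and spanning sets for exterior powers of integer vectors\<close>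

lemma tuples_Zpow: "xs \<in> tuples (Zpow n) r \<longleftrightarrow> length xs = r \<and> set xs \<subseteq> carrier_vec n"
  by (simp add: tuples_def)

lemma group_Zpow: "group (Zpow n)"
  using comm_group_vec by (rule comm_group.axioms(2))

text \<open>With the last \<open>n - r\<close> rows frozen, the determinant is additive and
  alternating in the first \<open>r\<close>.\<close>

lemma det_functional_left:
  assumes r: "r \<le> n" and ys: "ys \<in> tuples (Zpow n) (n - r)"
  shows "\<exists>h \<in> hom (ext_power_Z r n) integer_group.
    \<forall>xs \<in> tuples (Zpow n) r. h (wedge (Zpow n) xs) = det (mat_of_rows n (xs @ ys))"
proof -
  have app: "length (xs @ ys) = n" "set (xs @ ys) \<subseteq> carrier_vec n" if "xs \<in> tuples (Zpow n) r" for xs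
    using that ys r by (auto simp: tuples_Zpow)
  show ?thesis
  proof (rule ext_power_universal[OF group_Zpow[of n] abelian_integer_group,
        of r "\<lambda>xs. det (mat_of_rows n (xs @ ys))"])
    fix xs :: "int vec list" and i and x y :: "int vec"
    assume "xs \<in> tuples (Zpow n) r" "i < r" "x \<in> carrier (Zpow n)" "y \<in> carrier (Zpow n)"
    then show "det (mat_of_rows n (xs[i := x \<otimes>\<^bsub>Zpow n\<^esub> y] @ ys)) =
      det (mat_of_rows n (xs[i := x] @ ys)) \<otimes>\<^bsub>integer_group\<^esub> det (mat_of_rows n (xs[i := y] @ ys))"
      using det_mat_of_rows_add[OF app, of xs i x y] r by (simp add: tuples_Zpow list_update_append1)
  next
    fix xs :: "int vec list" and i j
    assume "xs \<in> tuples (Zpow n) r" "i < j" "j < r" "xs ! i = xs ! j"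
    then show "det (mat_of_rows n (xs @ ys)) = \<one>\<^bsub>integer_group\<^esub>"
      using det_mat_of_rows_repeated[OF app, of xs i j] r by (simp add: tuples_Zpow nth_append)
  qed auto
qed

lemma det_functional_right:
  assumes r: "r \<le> n" and xs: "xs \<in> tuples (Zpow n) r"
  shows "\<exists>h \<in> hom (ext_power_Z (n - r) n) integer_group.
    \<forall>ys \<in> tuples (Zpow n) (n - r). h (wedge (Zpow n) ys) = det (mat_of_rows n (xs @ ys))"
proof -
  have app: "length (xs @ ys) = n" "set (xs @ ys) \<subseteq> carrier_vec n" if "ys \<in> tuples (Zpow n) (n - r)" for ys
    using that xs r by (auto simp: tuples_Zpow)
  have upd: "(xs @ ys)[r + i := x] = xs @ ys[i := x]" for ys i x
    using xs by (simp add: tuples_Zpow list_update_append)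
  have nth: "(xs @ ys) ! (r + i) = ys ! i" for ys i
    using xs by (simp add: tuples_Zpow nth_append)
  show ?thesis
  proof (rule ext_power_universal[OF group_Zpow[of n] abelian_integer_group,
        of "n - r" "\<lambda>ys. det (mat_of_rows n (xs @ ys))"])
    fix ys :: "int vec list" and i and x y :: "int vec"
    assume "ys \<in> tuples (Zpow n) (n - r)" "i < n - r" "x \<in> carrier (Zpow n)" "y \<in> carrier (Zpow n)"
    then show "det (mat_of_rows n (xs @ ys[i := x \<otimes>\<^bsub>Zpow n\<^esub> y])) =
      det (mat_of_rows n (xs @ ys[i := x])) \<otimes>\<^bsub>integer_group\<^esub> det (mat_of_rows n (xs @ ys[i := y]))"
      using det_mat_of_rows_add[OF app, of ys "r + i" x y] r by (simp add: upd)
  next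
    fix ys :: "int vec list" and i j
    assume "ys \<in> tuples (Zpow n) (n - r)" "i < j" "j < n - r" "ys ! i = ys ! j"
    then show "det (mat_of_rows n (xs @ ys)) = \<one>\<^bsub>integer_group\<^esub>"
      using det_mat_of_rows_repeated[OF app, of ys "r + i" "r + j"] r by (simp add: nth)
  qed auto
qed

text \<open>Sorting picks one ordering of each index set, so subsets of size \<open>r\<close> index
  the usual basis candidates.\<close>

definition unit_tuple :: "nat \<Rightarrow> nat set \<Rightarrow> int vec list" where
  "unit_tuple n I = map (unit_vec n) (sorted_list_of_set I)"

lemma unit_tuple_in_tuples:
  "finite I \<Longrightarrow> card I = r \<Longrightarrow> unit_tuple n I \<in> tuples (Zpow n) r"
  by (auto simp: tuples_Zpow unit_tuple_def)

text \<open>Tuples of unit vectors suffice. A repeated index gives the trivial wedge, and distinct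
  indices are a permutation of their sorted list.\<close>

lemma ext_power_Z_spanned:
  assumes S: "subgroup S (ext_power_Z r n)"
    and w: "\<And>I. I \<subseteq> {..<n} \<Longrightarrow> card I = r \<Longrightarrow> wedge (Zpow n) (unit_tuple n I) \<in> S"
  shows "S = carrier (ext_power_Z r n)"
proof (rule ext_power_minimal_generators[OF group_Zpow S _ generate_unit_vecs])
  show "unit_vec n ` {..<n} \<subseteq> carrier (Zpow n)" by auto
  fix xs :: "int vec list" assume xs: "length xs = r" "set xs \<subseteq> unit_vec n ` {..<n}"
  then have t: "xs \<in> tuples (Zpow n) r" by (auto simp: tuples_Zpow)
  define js where "js = map (inv_into {..<n} (unit_vec n)) xs"
  have "unit_vec n (inv_into {..<n} (unit_vec n) x) = x" "inv_into {..<n} (unit_vec n) x \<in> {..<n}"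
    if "x \<in> set xs" for x
    using f_inv_into_f[OF subsetD[OF xs(2) that]] inv_into_into[OF subsetD[OF xs(2) that]] .
  then have js: "xs = map (unit_vec n) js" "set js \<subseteq> {..<n}"
    by (auto simp: js_def map_idI)
  show "wedge (Zpow n) xs \<in> S"
  proof (cases "distinct js")
    case True
    let ?ks = "sorted_list_of_set (set js)"
    have "mset js = mset ?ks" using set_eq_iff_mset_eq_distinct[OF True, of ?ks] by simp
    then obtain p where p: "p permutes {..<length ?ks}" "permute_list p ?ks = js"
      by (rule mset_eq_permutation)
    have card: "card (set js) = r" using True js(1) xs(1) by (simp add: distinct_card)
    have "wedge (Zpow n) (permute_list p (unit_tuple n (set js))) \<in> S"
      using p(1) card js(2) w
      by (intro wedge_permute[OF group_Zpow S] unit_tuple_in_tuples) auto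
    moreover have "permute_list p (unit_tuple n (set js)) = xs"
      unfolding unit_tuple_def permute_list_map[OF p(1)] p(2) js(1) ..
    ultimately show ?thesis by simp
  next
    case False
    then obtain i j where "i < j" "j < length js" "js ! i = js ! j"
      by (metis distinct_conv_nth linorder_neqE_nat)
    then have "wedge (Zpow n) xs = \<one>\<^bsub>ext_power_Z r n\<^esub>"
      using wedge_repeated[OF group_Zpow t, of i j] js(1) xs(1) by simp
    then show ?thesis using subgroup.one_closed[OF S] by simp
  qed
qed

section \<open>Assembling the pairing and the equivalence\<close>

lemma minus_id_hom:
  assumes "comm_group G" "f \<in> hom G G"
  shows "minus_id G f \<in> hom G G"
proof -
  interpret comm_group G by fact
  have [simp]: "f x \<in> carrier G" if "x \<in> carrier G" for x using that assms(2) by (auto simp: hom_def)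
  show ?thesis
    by (intro homI) (auto simp: minus_id_def hom_mult[OF assms(2)] inv_mult m_ac)
qed

text \<open>Two signed dual bases with the same signs are built, one for each exterior power, and
  their coordinates turn the endomorphisms into matrices of the same size.\<close>

lemma ext_power_pairing:
  fixes A :: "int mat"
  assumes A: "A \<in> carrier_mat n n" and det: "det A = 1" and r: "r \<le> n"
  defines "K \<equiv> n choose r"
  obtains \<Phi> \<Psi> B C where "\<Phi> \<in> iso (ext_power_Z r n) (Zpow K)" "\<Psi> \<in> iso (ext_power_Z (n - r) n) (Zpow K)"
    "mat_equiv K (B - 1\<^sub>m K) (C - 1\<^sub>m K)"
    "\<forall>x \<in> carrier (ext_power_Z r n). \<Phi> (ext_minus_id r n A x) = (B - 1\<^sub>m K) *\<^sub>v \<Phi> x"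
    "\<forall>y \<in> carrier (ext_power_Z (n - r) n). \<Psi> (ext_minus_id (n - r) n A y) = (C - 1\<^sub>m K) *\<^sub>v \<Psi> y"
proof -
  let ?D = "\<lambda>xs. det (mat_of_rows n xs) :: int" and ?T = "tuples (Zpow n)" and ?w = "wedge (Zpow n)"
  let ?A = "(*\<^sub>v) A"
  have "card {I. I \<subseteq> {..<n} \<and> card I = r} = K" by (simp add: n_subsets K_def)
  moreover have "finite {I. I \<subseteq> {..<n} \<and> card I = r}" by simp
  ultimately obtain e where e: "bij_betw e {0..<K} {I. I \<subseteq> {..<n} \<and> card I = r}"
    using ex_bij_betw_nat_finite by metis
  have eI: "e k \<subseteq> {..<n}" "card (e k) = r" "finite (e k)" if "k < K" for k
  proof -
    have "e k \<in> {I. I \<subseteq> {..<n} \<and> card I = r}" using bij_betwE[OF e] that by simp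
    then show "e k \<subseteq> {..<n}" "card (e k) = r" "finite (e k)" by (auto intro: finite_subset)
  qed
  have e_onto: "\<exists>k<K. e k = I" if "I \<subseteq> {..<n}" "card I = r" for I
  proof -
    have "I \<in> e ` {0..<K}" using bij_betw_imp_surj_on[OF e] that by simp
    then show ?thesis by auto
  qed
  \<comment> \<open>One index \<open>k\<close> serves a subset and its complement. This makes the
    pairing diagonal and gives both groups the rank \<open>n choose r\<close>.\<close>
  define bs where "bs k = unit_tuple n (e k)" for k
  define cs where "cs k = unit_tuple n ({..<n} - e k)" for k
  have bs: "bs k \<in> ?T r" if "k < K" for k
    using eI[OF that] by (simp add: bs_def unit_tuple_in_tuples)
  have cs: "cs k \<in> ?T (n - r)" if "k < K" for k
    using eI[OF that] by (simp add: cs_def unit_tuple_in_tuples card_Diff_subset)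
  define s where "s k = ?D (bs k @ cs k)" for k
  have ss: "s k * s k = 1" if k: "k < K" for k
  proof -
    let ?is = "sorted_list_of_set (e k) @ sorted_list_of_set ({..<n} - e k)"
    have "distinct ?is" "set ?is \<subseteq> {..<n}" using eI[OF k] by auto
    moreover have "length ?is = n" using eI[OF k] r by (simp add: card_Diff_subset)
    ultimately show ?thesis using det_mat_of_rows_unit_vecs[of ?is n, where 'a = int]
      by (simp add: s_def bs_def cs_def unit_tuple_def)
  qed
  have D: "?D (bs k @ cs l) = (if k = l then s k else 0)" if kl: "k < K" "l < K" for k l
  proof (cases "k = l")
    case False
    then have "e k \<noteq> e l" using bij_betw_imp_inj_on[OF e] kl by (auto simp: inj_on_def)
    \<comment> \<open>Distinct sets of equal size are not nested, so some index occurs in both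
      \<open>bs k\<close> and \<open>cs l\<close>, and the determinant has a repeated row.\<close>
    then have "\<not> e k \<subseteq> e l" using eI kl by (metis card_subset_eq)
    then obtain i where i: "i \<in> e k" "i \<in> {..<n} - e l" using eI(1)[OF kl(1)] by blast
    have "unit_vec n i \<in> set (bs k)" "unit_vec n i \<in> set (cs l)"
      using i eI[OF kl(1)] by (auto simp: bs_def cs_def unit_tuple_def)
    then obtain a b where "a < length (bs k)" "bs k ! a = unit_vec n i" "b < length (cs l)" "cs l ! b = unit_vec n i"
      unfolding in_set_conv_nth by blast
    then have "?D (bs k @ cs l) = 0"
      using bs[OF kl(1)] cs[OF kl(2)] r
      by (intro det_mat_of_rows_repeated[of _ _ a "length (bs k) + b"]) (auto simp: tuples_Zpow nth_append)
    then show ?thesis using False by simp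
  qed (simp add: s_def)
  obtain L where L: "\<And>ys. ys \<in> ?T (n - r) \<Longrightarrow> L ys \<in> hom (ext_power_Z r n) integer_group"
    "\<And>xs ys. ys \<in> ?T (n - r) \<Longrightarrow> xs \<in> ?T r \<Longrightarrow> L ys (?w xs) = ?D (xs @ ys)"
    using det_functional_left[OF r] by metis
  obtain R where R: "\<And>xs. xs \<in> ?T r \<Longrightarrow> R xs \<in> hom (ext_power_Z (n - r) n) integer_group"
    "\<And>xs ys. xs \<in> ?T r \<Longrightarrow> ys \<in> ?T (n - r) \<Longrightarrow> R xs (?w ys) = ?D (xs @ ys)"
    using det_functional_right[OF r] by metis
  have E: "comm_group (ext_power_Z q n)" for q by (rule comm_group_ext_power[OF group_Zpow])
  \<comment> \<open>Pairing with the complementary tuple is the dual functional: by \<open>D\<close>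
    it sees only its own basis element, up to \<open>s k\<close>.\<close>
  interpret P: signed_dual_basis "ext_power_Z r n" K "\<lambda>k. ?w (bs k)" "\<lambda>k. L (cs k)" s
  proof (intro signed_dual_basis.intro signed_dual_basis_axioms.intro E)
    show "?w (bs k) \<in> carrier (ext_power_Z r n)" if "k < K" for k
      using wedge_closed[OF group_Zpow bs[OF that]] .
    show "S = carrier (ext_power_Z r n)"
      if "subgroup S (ext_power_Z r n)" "\<And>k. k < K \<Longrightarrow> ?w (bs k) \<in> S" for S
      using ext_power_Z_spanned[OF that(1)] that(2) e_onto unfolding bs_def by metis
  qed (auto simp: L bs cs D ss)
  interpret Q: signed_dual_basis "ext_power_Z (n - r) n" K "\<lambda>k. ?w (cs k)" "\<lambda>k. R (bs k)" s
  proof (intro signed_dual_basis.intro signed_dual_basis_axioms.intro E)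
    show "?w (cs k) \<in> carrier (ext_power_Z (n - r) n)" if "k < K" for k
      using wedge_closed[OF group_Zpow cs[OF that]] .
    show "S = carrier (ext_power_Z (n - r) n)"
      if S: "subgroup S (ext_power_Z (n - r) n)" and c: "\<And>k. k < K \<Longrightarrow> ?w (cs k) \<in> S" for S
    proof (rule ext_power_Z_spanned[OF S])
      fix I assume I: "I \<subseteq> {..<n}" "card I = n - r"
      then have "card ({..<n} - I) = r" using r by (simp add: card_Diff_subset finite_subset)
      then obtain k where k: "k < K" "e k = {..<n} - I" using e_onto[of "{..<n} - I"] by blast
      then have "cs k = unit_tuple n I" using I by (simp add: cs_def double_diff)
      then show "?w (unit_tuple n I) \<in> S" using c[OF k(1)] by simp
    qed
  qed (auto simp: R bs cs D ss)
  have Ahom: "?A \<in> hom (Zpow n) (Zpow n)" by (rule mult_mat_vec_hom_Zpow[OF A])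
  have mapT: "map ?A xs \<in> ?T q" if "xs \<in> ?T q" for xs q
    using that A by (auto simp: tuples_Zpow)
  let ?f = "ext_map r (Zpow n) ?A" and ?g = "ext_map (n - r) (Zpow n) ?A"
  have f: "?f \<in> hom (ext_power_Z r n) (ext_power_Z r n)"
    and g: "?g \<in> hom (ext_power_Z (n - r) n) (ext_power_Z (n - r) n)"
    using ext_map_hom[OF group_Zpow Ahom] by auto
  have fw: "?f (?w (bs k)) = ?w (map ?A (bs k))" and gw: "?g (?w (cs k)) = ?w (map ?A (cs k))" if "k < K" for k
    using ext_map_wedge[OF group_Zpow Ahom] bs cs that by auto
  define S where "S = mat K K (\<lambda>(k, l). if k = l then s k else 0)"
  have S: "S \<in> carrier_mat K K" by (simp add: S_def)
  have S_mult: "S * M = mat K K (\<lambda>(k, l). s k * M $$ (k, l))" if M: "M \<in> carrier_mat K K" for M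
  proof (intro eq_matI)
    fix k l assume "k < dim_row (mat K K (\<lambda>(k, l). s k * M $$ (k, l)))" "l < dim_col (mat K K (\<lambda>(k, l). s k * M $$ (k, l)))"
    then have kl: "k < K" "l < K" by auto
    have "(S * M) $$ (k, l) = (\<Sum>i=0..<K. (if k = i then s k else 0) * M $$ (i, l))"
      using kl M by (simp add: S_def scalar_prod_def)
    also have "\<dots> = (\<Sum>i=0..<K. if k = i then s k * M $$ (k, l) else 0)" by (intro sum.cong) auto
    finally show "(S * M) $$ (k, l) = mat K K (\<lambda>(k, l). s k * M $$ (k, l)) $$ (k, l)" using kl by simp
  qed (use M S in auto)
  have SS: "S * S = 1\<^sub>m K" unfolding S_mult[OF S] by (intro eq_matI) (auto simp: S_def ss)
  let ?B = "P.coord_mat ?f" and ?C = "Q.coord_mat ?g"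
  have "transpose_mat ?B * (S * ?C) = S"
  proof (intro eq_matI)
    fix i j assume "i < dim_row S" "j < dim_col S"
    then have ij: "i < K" "j < K" using S by auto
    let ?xs = "map ?A (bs i)" and ?ys = "map ?A (cs j)"
    have t: "?xs \<in> ?T r" "?ys \<in> ?T (n - r)" using ij bs cs mapT by auto
    have tb: "length (bs i @ cs j) = n" "set (bs i @ cs j) \<subseteq> carrier_vec n"
      using bs[OF ij(1)] cs[OF ij(2)] r by (auto simp: tuples_Zpow)
    \<comment> \<open>Since \<open>R (bs k)\<close> at \<open>?ys\<close> equals
      \<open>L ?ys\<close> at \<open>bs k\<close>, the sum is the expansion of the functional
      \<open>L ?ys\<close> at \<open>?xs\<close>. Its value is a determinant of images under
      \<open>A\<close>, which invariance reduces to \<open>D\<close>.\<close>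
    have "(\<Sum>k<K. s k * L (cs k) (?w ?xs) * R (bs k) (?w ?ys)) = (\<Sum>k<K. s k * L (cs k) (?w ?xs) * L ?ys (?w (bs k)))"
      using t by (intro sum.cong) (auto simp: L R bs cs)
    also have "\<dots> = L ?ys (?w ?xs)"
      using P.functional_expansion[OF L(1)[OF t(2)] wedge_closed[OF group_Zpow t(1)]] by simp
    also have "\<dots> = ?D (map ?A (bs i @ cs j))" using L(2)[OF t(2,1)] by simp
    also have "\<dots> = (if i = j then s i else 0)"
      using det_mat_of_rows_mult[OF A tb] det D[OF ij] by simp
    finally have key: "(\<Sum>k<K. s k * L (cs k) (?w ?xs) * R (bs k) (?w ?ys)) = (if i = j then s i else 0)" .
    have "(transpose_mat ?B * (S * ?C)) $$ (i, j) =
      (\<Sum>k<K. (L (cs k) (?w ?xs) * s i) * (s k * (R (bs k) (?w ?ys) * s j)))"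
      using ij fw[OF ij(1)] gw[OF ij(2)]
      by (simp add: S_mult P.coord_mat_def Q.coord_mat_def scalar_prod_def lessThan_atLeast0)
    \<comment> \<open>These two signs come from the columns of the coordinate matrices; on the
      diagonal their product is \<open>1\<close>, and elsewhere the sum vanishes.\<close>
    also have "\<dots> = s i * s j * (\<Sum>k<K. s k * L (cs k) (?w ?xs) * R (bs k) (?w ?ys))"
      by (simp add: sum_distrib_left mult_ac)
    also have "\<dots> = S $$ (i, j)" unfolding key using ij ss[OF ij(1)] by (auto simp: S_def)
    finally show "(transpose_mat ?B * (S * ?C)) $$ (i, j) = S $$ (i, j)" .
  qed (use S in \<open>auto simp: P.coord_mat_def Q.coord_mat_def\<close>)
  then have BC: "mat_equiv K (?B - 1\<^sub>m K) (?C - 1\<^sub>m K)"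
    using mat_equiv_dual[OF P.coord_mat_carrier Q.coord_mat_carrier S SS] by simp
  have Pm: "\<forall>x \<in> carrier (ext_power_Z r n). P.coords (ext_minus_id r n A x) = (?B - 1\<^sub>m K) *\<^sub>v P.coords x"
    unfolding ext_minus_id_def by (intro ballI P.coords_minus_id[OF f])
  have Qm: "\<forall>y \<in> carrier (ext_power_Z (n - r) n). Q.coords (ext_minus_id (n - r) n A y) = (?C - 1\<^sub>m K) *\<^sub>v Q.coords y"
    unfolding ext_minus_id_def by (intro ballI Q.coords_minus_id[OF g])
  show thesis by (rule that[OF P.coords_iso Q.coords_iso BC Pm Qm])
qed

text \<open>Moving the right multiplier \<open>V\<close> across as its inverse \<open>W\<close>
  gives \<open>(C - 1) * W = U * (B - 1)\<close>, which has the shape of \<open>endos_equiv\<close>: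
  \<open>U\<close> yields \<open>\<alpha>\<close> and \<open>W\<close> yields
  \<open>\<beta>\<close>.\<close>

lemma endos_equiv_ext_minus_id:
  fixes A :: "int mat"
  assumes "A \<in> carrier_mat n n" and "det A = 1" and "r \<le> n"
  shows "endos_equiv (ext_power_Z r n) (ext_power_Z (n - r) n) (ext_minus_id r n A) (ext_minus_id (n - r) n A)"
proof -
  let ?K = "n choose r" and ?E = "ext_power_Z r n" and ?F = "ext_power_Z (n - r) n"
  let ?f = "ext_minus_id r n A" and ?g = "ext_minus_id (n - r) n A"
  obtain \<Phi> \<Psi> B C where \<Phi>: "\<Phi> \<in> iso ?E (Zpow ?K)" and \<Psi>: "\<Psi> \<in> iso ?F (Zpow ?K)"
    and BC: "mat_equiv ?K (B - 1\<^sub>m ?K) (C - 1\<^sub>m ?K)"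
    and f: "\<forall>x \<in> carrier ?E. \<Phi> (?f x) = (B - 1\<^sub>m ?K) *\<^sub>v \<Phi> x"
    and g: "\<forall>y \<in> carrier ?F. \<Psi> (?g y) = (C - 1\<^sub>m ?K) *\<^sub>v \<Psi> y"
    by (rule ext_power_pairing[OF assms]) (rule that, assumption+)
  obtain U V where U: "U \<in> carrier_mat ?K ?K" "det U dvd 1" and V: "V \<in> carrier_mat ?K ?K" "det V dvd 1"
    and UV: "C - 1\<^sub>m ?K = U * (B - 1\<^sub>m ?K) * V"
    using BC unfolding mat_equiv_def by blast
  note c = mat_equiv_carrier(1)[OF BC]
  obtain W where W: "W \<in> carrier_mat ?K ?K" "V * W = 1\<^sub>m ?K" "det W dvd 1"
    using is_unit_detE[OF V] by blast
  have "(C - 1\<^sub>m ?K) * W = U * (B - 1\<^sub>m ?K) * (V * W)"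
    using U V W(1) c unfolding UV by (simp add: assoc_mult_mat[of _ ?K ?K _ ?K _ ?K])
  then have eq: "(C - 1\<^sub>m ?K) * W = U * (B - 1\<^sub>m ?K)" using U c W(2) by simp
  have CK: "C - 1\<^sub>m ?K \<in> carrier_mat ?K ?K" using mat_equiv_carrier(2)[OF BC] .
  have F: "group ?F" and E: "comm_group ?E"
    using comm_group_ext_power[OF group_Zpow] by (auto simp: comm_group_def)
  let ?i = "inv_into (carrier ?F) \<Psi>"
  define \<alpha> where "\<alpha> = ?i \<circ> ((*\<^sub>v) U \<circ> \<Phi>)"
  define \<beta> where "\<beta> = ?i \<circ> ((*\<^sub>v) W \<circ> \<Phi>)"
  note i = group.iso_set_sym[OF F \<Psi>]
  have \<alpha>: "\<alpha> \<in> iso ?E ?F" unfolding \<alpha>_def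
    by (intro iso_set_trans[OF iso_set_trans[OF \<Phi> mult_mat_vec_iso_Zpow[OF U]] i])
  have \<beta>: "\<beta> \<in> iso ?E ?F" unfolding \<beta>_def
    by (intro iso_set_trans[OF iso_set_trans[OF \<Phi> mult_mat_vec_iso_Zpow[OF W(1,3)]] i])
  have fhom: "?f \<in> hom ?E ?E" and ghom: "?g \<in> hom ?F ?F"
    unfolding ext_minus_id_def
    by (intro minus_id_hom comm_group_ext_power group_Zpow ext_map_hom mult_mat_vec_hom_Zpow assms(1))+
  have \<Psi>i: "\<Psi> (?i v) = v" if "v \<in> carrier_vec ?K" for v
    using \<Psi> that by (auto simp: iso_iff intro: f_inv_into_f)
  have "\<alpha> (?f x) = ?g (\<beta> x)" if x: "x \<in> carrier ?E" for x
  proof -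
    have fx: "?f x \<in> carrier ?E" and bx: "\<beta> x \<in> carrier ?F" and ax: "\<alpha> (?f x) \<in> carrier ?F"
      and gx: "?g (\<beta> x) \<in> carrier ?F"
      using fhom ghom \<alpha> \<beta> x by (auto simp: iso_def hom_def Pi_iff)
    have cx: "\<Phi> x \<in> carrier_vec ?K" "\<Phi> (?f x) \<in> carrier_vec ?K" using \<Phi> x fx by (auto simp: iso_iff)
    have "\<Psi> (\<alpha> (?f x)) = U *\<^sub>v ((B - 1\<^sub>m ?K) *\<^sub>v \<Phi> x)"
      using \<Psi>i[of "U *\<^sub>v \<Phi> (?f x)"] cx U by (simp add: \<alpha>_def bspec[OF f x])
    also have "\<dots> = (C - 1\<^sub>m ?K) *\<^sub>v (W *\<^sub>v \<Phi> x)"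
      using assoc_mult_mat_vec[OF U(1) c cx(1)] assoc_mult_mat_vec[OF CK W(1) cx(1)] eq by simp
    also have "\<dots> = \<Psi> (?g (\<beta> x))"
      using \<Psi>i[of "W *\<^sub>v \<Phi> x"] cx W bspec[OF g bx] by (simp add: \<beta>_def)
    finally show ?thesis using \<Psi> ax gx by (auto simp: iso_iff inj_on_def)
  qed
  then show ?thesis unfolding endos_equiv_def using \<alpha> \<beta> by blast
qed

theorem proposition4p1:
  fixes n r :: nat and A :: "int mat"
  assumes "A \<in> carrier_mat n n" and "det A = 1" and "r \<le> n"
  shows "ext_power_Z r n \<cong> Zpow (n choose r) \<and>
         ext_power_Z (n - r) n \<cong> Zpow (n choose r) \<and>
         (\<forall>\<phi> \<in> iso (ext_power_Z r n) (Zpow (n choose r)).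
          \<forall>\<psi> \<in> iso (ext_power_Z (n - r) n) (Zpow (n choose r)).
            equivalent_endos (Zpow (n choose r))
              (transport (ext_power_Z r n) \<phi> (ext_minus_id r n A))
              (transport (ext_power_Z (n - r) n) \<psi> (ext_minus_id (n - r) n A))) \<and>
         coker (ext_power_Z r n) (ext_minus_id r n A) \<cong>
           coker (ext_power_Z (n - r) n) (ext_minus_id (n - r) n A)"
proof -
  have E: "comm_group (ext_power_Z q n)" "group (ext_power_Z q n)" for q
    using comm_group_ext_power[OF group_Zpow] by (auto simp: comm_group_def)
  have hom: "ext_minus_id q n A \<in> hom (ext_power_Z q n) (ext_power_Z q n)" for q
    unfolding ext_minus_id_def
    by (intro minus_id_hom E ext_map_hom group_Zpow mult_mat_vec_hom_Zpow assms(1))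
  \<comment> \<open>This equivalence involves no chosen bases, so it transports along arbitrary
    \<open>\<phi>\<close> and \<open>\<psi>\<close> and also passes to the cokernels.\<close>
  note e = endos_equiv_ext_minus_id[OF assms]
  obtain \<Phi> \<Psi> where "\<Phi> \<in> iso (ext_power_Z r n) (Zpow (n choose r))"
    "\<Psi> \<in> iso (ext_power_Z (n - r) n) (Zpow (n choose r))"
    by (rule ext_power_pairing[OF assms])
  then have "ext_power_Z r n \<cong> Zpow (n choose r)" "ext_power_Z (n - r) n \<cong> Zpow (n choose r)"
    by (auto intro: is_isoI)
  then show ?thesis
    using endos_equiv_transport[OF E(2) E(2) hom hom e] endos_equiv_coker[OF E(1) E(1) hom hom e] by blast
qed

end
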